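(* Let $\#^{S}$ be the operation on $\omega$-indexed sequences of ordinals defined in the context. (1) $\#^{S}$ is both weakly monotone and strictly monotone on z-special elements. (2) $\#^{S}$ is the smallest operation which is strictly monotone on z-special elements; that is, for every everywhere defined operation $\bigoplus$ from $\omega$-indexed sequences of ordinals to ordinals which is strictly monotone on z-special elements, and for every sequence $(\alpha_i)_{i<\omega}$ of ordinals, $\#^{S}_{i<\omega}\alpha_i\le\bigoplus_{i<\omega}\alpha_i$. (3) $\#^{S}$ is invariant under insertion of any number of $0$'s: if $f:\omega\to\omega$ is strictly increasing, $\beta_{f(i)}=\alpha_i$ for every $i<\omega$, and $\beta_j=0$ for every $j$ not in the range of $f$, then $\#^{S}_{i<\omega}\beta_i=\#^{S}_{i<\omega}\alpha_i$; likewise if finitely many or infinitely many zeros are inserted in any places. (4) If $\alpha_i=\alpha$ for every $i<\omega$, then $\#^{S}_{i<\omega}\alpha_i=\alpha\otimes\omega$.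
   Context: Notation. $+$ is the usual ordinal sum, $\#$ (binary or finitary) is the Hessenberg natural sum of ordinals, and $\otimes$ is the natural product of ordinals: $\omega^{\xi}\otimes\omega^{\rho}=\omega^{\xi\#\rho}$, extended to arbitrary ordinals in normal form by distributivity over $\#$, with $\alpha\otimes 0=0\otimes\alpha=0$. The ordinal $0$ is neither limit nor successor. Every nonzero ordinal $\zeta$ is uniquely written in (additive) normal form $\zeta=\omega^{\xi_s}+\dots+\omega^{\xi_1}+\omega^{\xi_0}$ with $\xi_s\ge\dots\ge\xi_0$; put $\hat\zeta=\omega^{\xi_s}+\dots+\omega^{\xi_1}$ (last summand removed; $\hat\zeta=0$ if there is only one summand). For a sequence $\bm\alpha=(\alpha_i)_{i<\omega}$ of ordinals, let $\varepsilon_{\bm\alpha}$ be the least ordinal $\varepsilon$ such that $\{i<\omega:\varepsilon\le\alpha_i\}$ is finite, and let $\zeta_{\bm\alpha}$ be the least ordinal $\zeta$ such that $\{i<\omega:\zeta<\alpha_i\}$ is finite. The element $\alpha_i$ (for the index $i$) is e-special if $\alpha_i\ge\varepsilon_{\bm\alpha}$, and z-special if $\alpha_i>\zeta_{\bm\alpha}$. One always has $\zeta_{\bm\alpha}\le\varepsilon_{\bm\alpha}$. Definition of $\#^{S}$. Let $i_1,\dots,i_h$ enumerate the finite (possibly empty) set of indices of e-special elements of $\bm\alpha$. Let $\alpha_{i_p}^{\heartsuit}$ be the unique ordinal with $\zeta_{\bm\alpha}+\alpha_{i_p}^{\heartsuit}=\alpha_{i_p}$ and, if $\zeta_{\bm\alpha}>0$,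 let $\alpha_{i_p}^{\diamondsuit}$ be the unique ordinal with $\hat\zeta_{\bm\alpha}+\alpha_{i_p}^{\diamondsuit}=\alpha_{i_p}$. If $\zeta_{\bm\alpha}>0$, let $\omega^{\xi_0}$ be the last summand in the normal form of $\zeta_{\bm\alpha}$. (S1) If $\zeta_{\bm\alpha}>0$, $\xi_0$ is a limit ordinal, and only finitely many elements of $\bm\alpha$ are $\ge\zeta_{\bm\alpha}$ (i.e. $\zeta_{\bm\alpha}=\varepsilon_{\bm\alpha}$), then $\#^{S}_{i<\omega}\alpha_i=(\hat\zeta_{\bm\alpha}\otimes\omega)\,\#\,\omega^{\xi_0}\,\#\,\alpha_{i_1}^{\diamondsuit}\,\#\cdots\#\,\alpha_{i_h}^{\diamondsuit}$. (S2) Otherwise (including the case $\zeta_{\bm\alpha}=0$), $\#^{S}_{i<\omega}\alpha_i=(\zeta_{\bm\alpha}\otimes\omega)\,\#\,\alpha_{i_1}^{\heartsuit}\,\#\cdots\#\,\alpha_{i_h}^{\heartsuit}$. An everywhere defined operation $\bigoplus$ from $\omega$-indexed sequences of ordinals to ordinals is weakly monotone if $\bigoplus_{i<\omega}\alpha_i\le\bigoplus_{i<\omega}\beta_i$ whenever $\alpha_i\le\beta_i$ for every $i<\omega$. It is strictly monotone on z-special elements if, for all sequences $\bm\alpha,\bm\beta$ of ordinals, $\bigoplus_{i<\omega}\alpha_i<\bigoplus_{i<\omega}\beta_i$ whenever $\alpha_i\le\beta_i$ for every $i<\omega$ and there is at least one $\bar\imath<\omega$ such that $\zeta_{\bm\alpha}<\beta_{\bar\imath}$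 and $\alpha_{\bar\imath}<\beta_{\bar\imath}$. *)

theory Defs
  imports "HOL-Library.Infinite_Typeclass"
begin

section \<open>Ordinals as order types of well-orders\<close>

text \<open>
  An ordinal is a well-order up to isomorphism. The field of the well-order is a subset of the
  parameter type, so \<open>'a ordinal\<close> consists of the ordinals of cardinality at most
  \<open>|UNIV :: 'a set|\<close>. For infinite \<open>'a\<close> these are exactly the ordinals below the successor
  cardinal of \<open>|UNIV :: 'a set|\<close>; this cardinal is regular and uncountable, and the ordinals below
  it are closed under suprema of sequences (cf. \<open>ordinal_small_bounded\<close>) and under all the
  operations below.
\<close>

lemma ordIso_imp_Well_order: "(r, s) \<in> ordIso \<Longrightarrow> Well_order r \<and> Well_order s"
  by (auto simp: ordIso_def)

quotient_type 'a ordinal = "'a rel" / partial: "\<lambda>r s. (r, s) \<in> ordIso"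
proof (rule part_equivpI)
  show "\<exists>r :: 'a rel. (r, r) \<in> ordIso"
    by (rule exI[of _ "{}"]) (simp add: ordIso_reflexive)
  show "symp (\<lambda>r s :: 'a rel. (r, s) \<in> ordIso)"
    by (auto intro!: sympI dest: ordIso_symmetric)
  show "transp (\<lambda>r s :: 'a rel. (r, s) \<in> ordIso)"
    by (auto intro!: transpI dest: ordIso_transitive)
qed

lemma abs_ordinal_cases:
  obtains r where "Well_order r" "a = abs_ordinal r"
  using Quotient_abs_rep[OF Quotient_ordinal, of a] Quotient_rep_reflp[OF Quotient_ordinal, of a]
  by (metis ordIso_imp_Well_order)

instantiation ordinal :: (type) wellorder
begin

lift_definition less_eq_ordinal :: "'a ordinal \<Rightarrow> 'a ordinal \<Rightarrow> bool"
  is "\<lambda>r s. (r, s) \<in> ordLeq"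
  by (metis ordIso_ordLeq_trans ordIso_symmetric ordLeq_ordIso_trans)

lift_definition less_ordinal :: "'a ordinal \<Rightarrow> 'a ordinal \<Rightarrow> bool"
  is "\<lambda>r s. (r, s) \<in> ordLess"
  by (metis ordIso_ordLess_trans ordIso_symmetric ordLess_ordIso_trans)

instance
proof
  fix a b c :: "'a ordinal"
  show "a < b \<longleftrightarrow> a \<le> b \<and> \<not> b \<le> a"
    by transfer (metis not_ordLess_ordLeq ordLess_imp_ordLeq ordLess_or_ordLeq ordIso_imp_Well_order)
  show "a \<le> a"
    by transfer (simp add: ordIso_iff_ordLeq)
  show "a \<le> b \<Longrightarrow> b \<le> c \<Longrightarrow> a \<le> c"
    by transfer (rule ordLeq_transitive)
  show "a \<le> b \<Longrightarrow> b \<le> a \<Longrightarrow> a = b"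
    by transfer (simp add: ordIso_iff_ordLeq)
  show "a \<le> b \<or> b \<le> a"
    by transfer (metis ordLeq_total ordIso_imp_Well_order)
next
  fix P :: "'a ordinal \<Rightarrow> bool" and a
  assume step: "\<And>x. (\<And>y. y < x \<Longrightarrow> P y) \<Longrightarrow> P x"
  have P_abs: "P (abs_ordinal r)" if "Well_order r" for r :: "'a rel"
    using that
  proof (induction r rule: wf_induct_rule[OF wf_ordLess])
    case (1 r)
    show ?case
    proof (rule step)
      fix y assume "y < abs_ordinal r"
      moreover obtain s where s: "Well_order s" "y = abs_ordinal s"
        by (rule abs_ordinal_cases)
      ultimately have "(s, r) \<in> ordLess"
        using 1 by (simp add: less_ordinal.abs_eq ordIso_reflexive)
      then show "P y" using 1 s by simp
    qed
  qed
  show "P a"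
    by (rule abs_ordinal_cases[of a]) (simp add: P_abs)
qed

end

context
  includes cardinal_syntax
begin

lemma less_abs_ordinal [simp]:
  "Well_order r \<Longrightarrow> Well_order s \<Longrightarrow> abs_ordinal r < abs_ordinal s \<longleftrightarrow> r <o s"
  by (simp add: less_ordinal.abs_eq ordIso_reflexive)

lemma card_of_lessThan_ordinal: "|{..<a :: 'a ordinal}| \<le>o |UNIV :: 'a set|"
proof -
  obtain r where r: "Well_order r" "a = abs_ordinal r" by (rule abs_ordinal_cases)
  have "{..<a} \<subseteq> (\<lambda>x. abs_ordinal (Restr r (underS r x))) ` Field r"
  proof
    fix b assume "b \<in> {..<a}"
    moreover obtain s where s: "Well_order s" "b = abs_ordinal s" by (rule abs_ordinal_cases)
    ultimately have "s <o r" using r by simp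
    then obtain x where x: "x \<in> Field r" "s =o Restr r (underS r x)"
      using r s ordLess_iff_ordIso_Restr by blast
    then have "b = abs_ordinal (Restr r (underS r x))"
      using s Quotient_rel_abs[OF Quotient_ordinal] by metis
    then show "b \<in> (\<lambda>x. abs_ordinal (Restr r (underS r x))) ` Field r" using x by blast
  qed
  then have "|{..<a}| \<le>o |(\<lambda>x. abs_ordinal (Restr r (underS r x))) ` Field r|"
    by (rule card_of_mono1)
  also have "|(\<lambda>x. abs_ordinal (Restr r (underS r x))) ` Field r| \<le>o |Field r|"
    by (rule card_of_image)
  also have "|Field r| \<le>o |UNIV :: 'a set|"
    by (rule card_of_mono1) simp
  finally show ?thesis .
qed

lemma no_inj_ordinal: "\<not> inj (g :: 'a ordinal \<Rightarrow> 'a)"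
proof
  assume g: "inj g"
  define R :: "'a ordinal rel" where "R = {(x, y). x \<le> y}"
  have FR: "Field R = UNIV" by (auto simp: R_def Field_def)
  have "R - Id = {(x, y). x < y}" by (auto simp: R_def)
  then have "wf (R - Id)" by (simp add: wf)
  moreover have "Linear_order R"
    unfolding FR
    by (auto simp: linear_order_on_def partial_order_on_def preorder_on_def
        refl_on_def R_def total_on_def intro: transI antisymI)
  ultimately have R: "Well_order R" by (simp add: well_order_on_def)
  define r where "r = dir_image R g"
  have r: "Well_order r"
    unfolding r_def by (rule Well_order_dir_image[OF R]) (simp add: FR g)
  have Fr: "Field r = range g"
    by (simp add: r_def dir_image_Field FR)
  define k where "k y = abs_ordinal (Restr r (underS r (g y)))" for y
  have wo: "Well_order (Restr r A)" for A by (rule Well_order_Restr[OF r])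
  have less: "k y < abs_ordinal r" for y
    unfolding k_def using underS_Restr_ordLess[OF r, of "g y"] Fr wo r by auto
  have mono: "k x < k y" if "x < y" for x y
  proof -
    have "underS r (g x) \<subset> underS r (g y)"
      using that g by (fastforce simp: underS_def r_def dir_image_def R_def inj_eq)
    moreover have "ofilter r (underS r z)" for z
      using r by (simp add: wo_rel.underS_ofilter wo_rel_def)
    ultimately have "Restr r (underS r (g x)) <o Restr r (underS r (g y))"
      using ofilter_subset_ordLess[OF r] by blast
    then show ?thesis by (simp add: k_def wo)
  qed
  have "x \<le> k x" for x
  proof (induction x rule: less_induct)
    case (less x)
    show ?case
    proof (rule ccontr)
      assume "\<not> x \<le> k x"
      then have "k x < x" by simp
      then show False using less[of "k x"] mono[of "k x" x] by simp
    qed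
  qed
  then show False using less[of "abs_ordinal r"] by (meson not_le)
qed

end

lemma ordinal_small_bounded:
  fixes S :: "'a::infinite ordinal set"
  assumes "(card_of S, card_of (UNIV :: 'a set)) \<in> ordLeq"
  shows "\<exists>b. \<forall>a\<in>S. a < b"
proof (rule ccontr)
  assume "\<not> ?thesis"
  then have "(UNIV :: 'a ordinal set) = (\<Union>a\<in>S. insert a {..<a})"
    by (auto simp: not_less le_less)
  moreover have "(card_of (\<Union>a\<in>S. insert a {..<a}), card_of (UNIV :: 'a set)) \<in> ordLeq"
  proof (rule card_of_UNION_ordLeq_infinite[OF infinite_UNIV assms], rule ballI)
    fix a :: "'a ordinal"
    have "(card_of {a}, card_of (UNIV :: 'a set)) \<in> ordLeq"
      by (rule card_of_singl_ordLeq) simp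
    then have "(card_of ({a} \<union> {..<a}), card_of (UNIV :: 'a set)) \<in> ordLeq"
      using card_of_lessThan_ordinal
      by (rule card_of_Un_ordLeq_infinite_Field[OF _ _ _ card_of_Card_order, rotated])
        (simp_all add: Field_card_of infinite_UNIV)
    then show "(card_of (insert a {..<a}), card_of (UNIV :: 'a set)) \<in> ordLeq"
      by simp
  qed
  ultimately have "(card_of (UNIV :: 'a ordinal set), card_of (UNIV :: 'a set)) \<in> ordLeq"
    by simp
  then obtain g :: "'a ordinal \<Rightarrow> 'a" where "inj g"
    unfolding card_of_ordLeq[symmetric] by auto
  with no_inj_ordinal[of g] show False by contradiction
qed

text \<open>
  Comparison of ordinals over two possibly different parameter types; for equal types it is
  \<open>\<le>\<close>.
\<close>

definition ordinal_le :: "'a ordinal \<Rightarrow> 'b ordinal \<Rightarrow> bool" (infix "\<preceq>" 50) where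
  "a \<preceq> b \<longleftrightarrow> (rep_ordinal a, rep_ordinal b) \<in> ordLeq"

lemma ordinal_le_iff_le: "a \<preceq> b \<longleftrightarrow> a \<le> b" for a b :: "'a ordinal"
  by (simp add: ordinal_le_def less_eq_ordinal.rep_eq)


section \<open>Ordinal arithmetic\<close>

instantiation ordinal :: (type) zero
begin

lift_definition zero_ordinal :: "'a ordinal" is "{}"
  by (simp add: ordIso_reflexive)

instance ..

end

definition osuc :: "'a ordinal \<Rightarrow> 'a ordinal" where
  "osuc a = (LEAST b. a < b)"

definition is_succ :: "'a ordinal \<Rightarrow> bool" where
  "is_succ b \<longleftrightarrow> (\<exists>a. b = osuc a)"

definition is_limit :: "'a ordinal \<Rightarrow> bool" where
  "is_limit b \<longleftrightarrow> b \<noteq> 0 \<and> \<not> is_succ b"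

definition opred :: "'a ordinal \<Rightarrow> 'a ordinal" where
  "opred b = (THE a. b = osuc a)"

definition omega :: "'a ordinal" where
  "omega = (LEAST b. is_limit b)"

lemma less_osuc: "(a :: 'a::infinite ordinal) < osuc a"
proof -
  have "(card_of {a}, card_of (UNIV :: 'a set)) \<in> ordLeq"
    by (rule card_of_singl_ordLeq) simp
  from ordinal_small_bounded[OF this] have "\<exists>b. a < b" by simp
  then show ?thesis unfolding osuc_def by (rule LeastI_ex)
qed

lemma osuc_inject: "osuc a = osuc b \<longleftrightarrow> (a :: 'a::infinite ordinal) = b"
proof -
  have "osuc x \<le> y" if "x < y" for x y :: "'a ordinal"
    unfolding osuc_def using that by (rule Least_le)
  then show ?thesis
    by (metis (no_types) less_osuc leD linorder_cases)
qed

lemma opred_osuc: "opred (osuc a) = (a :: 'a::infinite ordinal)"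
  by (simp add: opred_def osuc_inject)

text \<open>
  Transfinite recursion with start value \<open>z\<close>, successor step \<open>s\<close> and suprema at limits.
\<close>

function ord_rec ::
  "'a::infinite ordinal \<Rightarrow> ('a ordinal \<Rightarrow> 'a ordinal) \<Rightarrow> 'a ordinal \<Rightarrow> 'a ordinal" where
  "ord_rec z s b =
    (if b = 0 then z
     else if is_succ b then s (ord_rec z s (opred b))
     else (LEAST c. \<forall>b'<b. ord_rec z s b' \<le> c))"
  by pat_completeness auto
termination
proof (relation "inv_image {(x, y). x < y} (\<lambda>(z, s, b). b)")
  show "wf (inv_image {(x :: 'a ordinal, y). x < y}
      (\<lambda>(z :: 'a ordinal, s :: 'a ordinal \<Rightarrow> 'a ordinal, b). b))"
    by (rule wf_inv_image[OF wf])
next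
  fix z :: "'a ordinal" and s :: "'a ordinal \<Rightarrow> 'a ordinal" and b :: "'a ordinal"
  assume "is_succ b"
  then have "opred b < b"
    by (auto simp: is_succ_def opred_osuc intro: less_osuc)
  then show "((z, s, opred b), (z, s, b)) \<in> inv_image {(x, y). x < y} (\<lambda>(z, s, b). b)"
    by simp
qed simp

declare ord_rec.simps [simp del]

instantiation ordinal :: (infinite) "{plus, times}"
begin

definition plus_ordinal :: "'a ordinal \<Rightarrow> 'a ordinal \<Rightarrow> 'a ordinal" where
  "a + b = ord_rec a osuc b"

definition times_ordinal :: "'a ordinal \<Rightarrow> 'a ordinal \<Rightarrow> 'a ordinal" where
  "a * b = ord_rec 0 (\<lambda>x. x + a) b"

instance ..

end

definition omega_pow :: "'a::infinite ordinal \<Rightarrow> 'a ordinal" where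
  "omega_pow b = ord_rec (osuc 0) (\<lambda>x. x * omega) b"

text \<open>\<open>left_diff b a\<close> is the unique solution of \<open>b + c = a\<close>; it exists only for \<open>b \<le> a\<close>.\<close>

definition left_diff :: "'a::infinite ordinal \<Rightarrow> 'a ordinal \<Rightarrow> 'a ordinal" where
  "left_diff b a = (THE c. b + c = a)"


section \<open>Normal form, natural sum and natural product\<close>

text \<open>
  An additive normal form \<open>\<omega>\<^bsup>\<xi>\<^sub>s\<^esup> + \<dots> + \<omega>\<^bsup>\<xi>\<^sub>0\<^esup>\<close> is given by the weakly decreasing list of its
  exponents \<open>[\<xi>\<^sub>s, \<dots>, \<xi>\<^sub>0]\<close>; the empty list stands for \<open>0\<close>.
\<close>

definition nf_val :: "'a::infinite ordinal list \<Rightarrow> 'a ordinal" where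
  "nf_val xs = foldr (\<lambda>\<xi> a. omega_pow \<xi> + a) xs 0"

definition normal_form :: "'a::infinite ordinal \<Rightarrow> 'a ordinal list" where
  "normal_form a = (THE xs. sorted_wrt (\<ge>) xs \<and> nf_val xs = a)"

definition last_exponent :: "'a::infinite ordinal \<Rightarrow> 'a ordinal" where
  "last_exponent a = last (normal_form a)"

definition drop_last_summand :: "'a::infinite ordinal \<Rightarrow> 'a ordinal" where
  "drop_last_summand a = nf_val (butlast (normal_form a))"

text \<open>
  Hessenberg's natural sum: rearrange all summands of the two normal forms in decreasing order.
\<close>

definition nat_sum :: "'a::infinite ordinal \<Rightarrow> 'a ordinal \<Rightarrow> 'a ordinal" (infixl "\<sharp>" 65) where
  "a \<sharp> b = nf_val (rev (sort (normal_form a @ normal_form b)))"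

definition nat_sum_list :: "'a::infinite ordinal list \<Rightarrow> 'a ordinal" where
  "nat_sum_list xs = foldr (\<sharp>) xs 0"

definition nat_prod :: "'a::infinite ordinal \<Rightarrow> 'a ordinal \<Rightarrow> 'a ordinal" (infixl "\<otimes>" 70) where
  "a \<otimes> b =
    nat_sum_list [omega_pow (\<xi> \<sharp> \<rho>). \<xi> \<leftarrow> normal_form a, \<rho> \<leftarrow> normal_form b]"


section \<open>The infinitary operation\<close>

definition eps :: "(nat \<Rightarrow> 'a ordinal) \<Rightarrow> 'a ordinal" where
  "eps \<alpha> = (LEAST \<epsilon>. finite {i. \<epsilon> \<le> \<alpha> i})"

definition zeta :: "(nat \<Rightarrow> 'a ordinal) \<Rightarrow> 'a ordinal" where
  "zeta \<alpha> = (LEAST \<zeta>. finite {i. \<zeta> < \<alpha> i})"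

definition e_special :: "(nat \<Rightarrow> 'a ordinal) \<Rightarrow> nat set" where
  "e_special \<alpha> = {i. eps \<alpha> \<le> \<alpha> i}"

text \<open>
  For \<open>\<zeta> = 0\<close> the local values \<open>\<zeta>'\<close> and \<open>\<xi>\<close> carry no meaning; they are used only in the first
  branch, which requires \<open>\<zeta> \<noteq> 0\<close>. The condition \<open>finite {i. \<zeta> \<le> \<alpha> i}\<close> is equivalent to
  \<open>\<zeta> = eps \<alpha>\<close>.
\<close>

definition S_sum :: "(nat \<Rightarrow> 'a::infinite ordinal) \<Rightarrow> 'a ordinal" where
  "S_sum \<alpha> =
    (let \<zeta> = zeta \<alpha>; \<zeta>' = drop_last_summand \<zeta>; \<xi> = last_exponent \<zeta>;
         I = sorted_list_of_set (e_special \<alpha>)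
     in if \<zeta> \<noteq> 0 \<and> is_limit \<xi> \<and> finite {i. \<zeta> \<le> \<alpha> i}
        then (\<zeta>' \<otimes> omega) \<sharp> omega_pow \<xi> \<sharp> nat_sum_list (map (\<lambda>i. left_diff \<zeta>' (\<alpha> i)) I)
        else (\<zeta> \<otimes> omega) \<sharp> nat_sum_list (map (\<lambda>i. left_diff \<zeta> (\<alpha> i)) I))"

definition weakly_monotone :: "((nat \<Rightarrow> 'a ordinal) \<Rightarrow> 'a ordinal) \<Rightarrow> bool" where
  "weakly_monotone F \<longleftrightarrow> (\<forall>\<alpha> \<beta>. (\<forall>i. \<alpha> i \<le> \<beta> i) \<longrightarrow> F \<alpha> \<le> F \<beta>)"

text \<open>
  The values of \<open>F\<close> may be ordinals over a parameter type larger than that of its arguments: an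
  operation on all ordinals need not map the ordinals over \<open>'a\<close> to ordinals over \<open>'a\<close>.
\<close>

definition strictly_monotone_on_z_special ::
  "((nat \<Rightarrow> 'a ordinal) \<Rightarrow> 'b ordinal) \<Rightarrow> bool" where
  "strictly_monotone_on_z_special F \<longleftrightarrow>
    (\<forall>\<alpha> \<beta>. (\<forall>i. \<alpha> i \<le> \<beta> i) \<and> (\<exists>i. zeta \<alpha> < \<beta> i \<and> \<alpha> i < \<beta> i) \<longrightarrow> F \<alpha> < F \<beta>)"

end

theory Submission
  imports Defs "HOL-Library.Multiset_Order"
begin

text \<open>
  Recording an ordinal by the multiset of exponents of its normal form identifies the ordinals with
  the finite multisets of ordinals under the multiset order (\<open>exps_less_iff\<close>,
  \<open>exps_of_exps\<close>). The natural sum becomes the union of multisets, and multiplication by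
  \<open>\<omega>\<close> applies the successor to every exponent. The value of the infinitary sum then is a finite
  multiset sum, and comparisons take place in an ordered cancellative monoid.

  Monotonicity. Let \<open>\<zeta>\<close> and \<open>\<zeta>'\<close> be the thresholds of two sequences \<open>\<alpha> \<le> \<beta>\<close>. If
  \<open>\<zeta> = \<zeta>'\<close>, the values are compared summand by summand. If \<open>\<zeta> < \<zeta>'\<close>, a finite
  part of \<open>\<alpha>\<close> exceeds \<open>\<zeta>\<close>, and each such element exceeds \<open>\<zeta>\<close> by at most the amount by
  which \<open>\<beta>\<close> exceeds \<open>\<zeta>'\<close> plus the difference \<open>d\<close> of the thresholds. Raising the
  threshold by \<open>d\<close> raises \<open>\<zeta> \<otimes> \<omega>\<close> by more than any finite multiple of \<open>d\<close>
  (\<open>osuc_exps_less\<close>), which pays for all these differences. If \<open>\<zeta>' = z + \<omega>\<^sup>x\<close> with \<open>x\<close> a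
  limit and only finitely many elements of \<open>\<beta>\<close> reach \<open>\<zeta>'\<close>, the value at \<open>\<beta>\<close> contains
  \<open>(z \<otimes> \<omega>) \<sharp> \<omega>\<^sup>x\<close> in place of \<open>\<zeta>' \<otimes> \<omega>\<close>. If \<open>\<zeta> \<le> z\<close>, the
  argument applies with \<open>z\<close> as the larger threshold; otherwise \<open>\<zeta> = z + r\<close> with
  \<open>r < \<omega>\<^sup>x\<close>. In both cases \<open>\<omega>\<^sup>x\<close> pays for the summands of \<open>\<alpha>\<close> that remain, as
  their exponents are below \<open>x\<close>.

  Minimality. Every \<open>c\<close> below the sum of \<open>\<alpha>\<close> is at most the sum of some \<open>\<beta> \<le> \<alpha>\<close> to
  which strict monotonicity applies (\<open>S_sum_reached_below\<close>). Hence, by induction on its value, the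
  sum is the least ordinal that strict monotonicity permits. The sequence \<open>\<beta>\<close> is found by looking
  at the summand that has to be decreased to get down to \<open>c\<close>: if it belongs to a single element of
  \<open>\<alpha>\<close>, decrease that element; otherwise cut \<open>\<alpha>\<close> down to a constant \<open>z < \<zeta>\<close> outside a
  finite set of indices (\<open>reached_below_cut\<close>). The finitely many retained elements and the choice
  of \<open>z\<close> make up for the loss in \<open>\<zeta> \<otimes> \<omega>\<close>.
\<close>

section \<open>Successors, limits and recursion\<close>

lemma zero_le_ordinal [simp]: "(0 :: 'a ordinal) \<le> a"
proof -
  obtain r where r: "Well_order r" "a = abs_ordinal r" by (rule abs_ordinal_cases)
  have "(({}, r) :: 'a rel \<times> 'a rel) \<in> ordLeq"
  proof -
    have "embed {} r id" by (simp add: embed_def)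
    moreover have "Well_order ({} :: 'a rel)" by simp
    ultimately show ?thesis using r(1) unfolding ordLeq_def by blast
  qed
  then show ?thesis
    using r by (simp add: zero_ordinal.abs_eq less_eq_ordinal.abs_eq ordIso_reflexive)
qed

lemma not_less_zero_ordinal [simp]: "\<not> a < (0 :: 'a ordinal)"
  by (simp add: not_less)

lemma le_zero_ordinal_iff [simp]: "a \<le> (0 :: 'a ordinal) \<longleftrightarrow> a = 0"
  by (auto intro: order_antisym)

lemma zero_less_ordinal_iff: "(0 :: 'a ordinal) < a \<longleftrightarrow> a \<noteq> 0"
  using zero_le_ordinal[of a] by (auto simp: le_less)

lemma osuc_le_iff [simp]: "osuc a \<le> b \<longleftrightarrow> a < (b :: 'a::infinite ordinal)"
  by (metis Least_le less_osuc less_le_trans osuc_def)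

lemma less_osuc_iff [simp]: "a < osuc b \<longleftrightarrow> a \<le> (b :: 'a::infinite ordinal)"
  by (meson leD leI osuc_le_iff)

lemma osuc_less_iff: "osuc a < osuc b \<longleftrightarrow> a < (b :: 'a::infinite ordinal)"
  by simp

lemma osuc_neq_zero [simp]: "osuc (a :: 'a::infinite ordinal) \<noteq> 0"
  using less_osuc[of a] by (metis not_less_zero_ordinal)

lemma ordinal_cases [case_names zero succ limit]:
  fixes a :: "'a::infinite ordinal"
  obtains "a = 0" | b where "a = osuc b" | "is_limit a"
  by (auto simp: is_limit_def is_succ_def)

lemma osuc_less_limit: "is_limit l \<Longrightarrow> a < l \<Longrightarrow> osuc a < (l :: 'a::infinite ordinal)"
  by (metis is_limit_def is_succ_def le_less osuc_le_iff)

lemma zero_less_limit: "is_limit l \<Longrightarrow> 0 < (l :: 'a::infinite ordinal)"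
  by (simp add: is_limit_def zero_less_ordinal_iff)

lemma ord_rec_zero [simp]: "ord_rec z s 0 = z"
  by (simp add: ord_rec.simps)

lemma ord_rec_osuc [simp]: "ord_rec z s (osuc b) = s (ord_rec z s b)"
  by (subst ord_rec.simps) (auto simp: is_succ_def opred_osuc)

text \<open>
  The suprema taken by \<open>ord_rec\<close> at limits exist: an initial segment of the ordinals is too small
  to be cofinal.
\<close>

lemma bounded_below_ordinal:
  fixes f :: "'a::infinite ordinal \<Rightarrow> 'a ordinal"
  shows "\<exists>c. \<forall>b'<b. f b' \<le> c"
proof -
  have "(card_of (f ` {..<b}), card_of (UNIV :: 'a set)) \<in> ordLeq"
    by (rule ordLeq_transitive[OF card_of_image card_of_lessThan_ordinal])
  from ordinal_small_bounded[OF this] show ?thesis by (auto intro: less_imp_le)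
qed

lemma ord_rec_limit_le_iff:
  assumes "is_limit b"
  shows "ord_rec z s b \<le> c \<longleftrightarrow> (\<forall>b'<b. ord_rec z s b' \<le> c)"
proof -
  have *: "ord_rec z s b = (LEAST c. \<forall>b'<b. ord_rec z s b' \<le> c)"
    using assms by (subst ord_rec.simps) (simp add: is_limit_def)
  have "\<forall>b'<b. ord_rec z s b' \<le> ord_rec z s b"
    unfolding * using bounded_below_ordinal[of b "ord_rec z s"] by (rule LeastI_ex)
  moreover have "ord_rec z s b \<le> c" if "\<forall>b'<b. ord_rec z s b' \<le> c"
    unfolding * using that by (rule Least_le)
  ultimately show ?thesis by (meson order_trans)
qed

lemma less_ord_rec_limit_iff:
  assumes "is_limit b"
  shows "c < ord_rec z s b \<longleftrightarrow> (\<exists>b'<b. c < ord_rec z s b')"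
  using ord_rec_limit_le_iff[OF assms] by (meson not_le)

lemma ord_rec_strict_mono:
  fixes s :: "'a::infinite ordinal \<Rightarrow> 'a ordinal"
  assumes s: "\<And>n. ord_rec z s n < s (ord_rec z s n)" and "a < b"
  shows "ord_rec z s a < ord_rec z s b"
  using \<open>a < b\<close>
proof (induction b rule: less_induct)
  case (less b)
  show ?case
  proof (cases b rule: ordinal_cases)
    case zero
    then show ?thesis using less by simp
  next
    case (succ c)
    then have "a < c \<or> a = c" using less by auto
    then show ?thesis
      using less.IH[of c] s[of c] succ by (auto intro: less_trans less_osuc)
  next
    case limit
    then have "ord_rec z s a < ord_rec z s (osuc a)" using s by simp
    then show ?thesis
      using limit less.prems osuc_less_limit[of b a] less_ord_rec_limit_iff by blast
  qed
qed

section \<open>Addition\<close>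

lemma add_zero_ordinal [simp]: "a + 0 = (a :: 'a::infinite ordinal)"
  by (simp add: plus_ordinal_def)

lemma add_osuc [simp]: "a + osuc b = osuc (a + b :: 'a::infinite ordinal)"
  by (simp add: plus_ordinal_def)

lemma less_add_limit_iff:
  "is_limit b \<Longrightarrow> c < a + b \<longleftrightarrow> (\<exists>b'<b. c < a + (b' :: 'a::infinite ordinal))"
  by (simp add: plus_ordinal_def less_ord_rec_limit_iff)

lemma add_limit_le_iff:
  "is_limit b \<Longrightarrow> a + b \<le> c \<longleftrightarrow> (\<forall>b'<b. a + (b' :: 'a::infinite ordinal) \<le> c)"
  by (simp add: plus_ordinal_def ord_rec_limit_le_iff)

lemma add_less_cancel_ordinal [simp]: "a + b < a + c \<longleftrightarrow> b < (c :: 'a::infinite ordinal)"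
  using ord_rec_strict_mono[of a osuc] unfolding plus_ordinal_def
  by (metis less_osuc linorder_neqE not_less_iff_gr_or_eq)

lemma add_le_cancel_ordinal [simp]: "a + b \<le> a + c \<longleftrightarrow> b \<le> (c :: 'a::infinite ordinal)"
  by (meson add_less_cancel_ordinal not_le)

lemma add_eq_cancel_ordinal [simp]: "a + b = a + c \<longleftrightarrow> b = (c :: 'a::infinite ordinal)"
  by (simp add: eq_iff)

lemma le_add_ordinal [simp]: "a \<le> a + (b :: 'a::infinite ordinal)"
  using add_le_cancel_ordinal[of a 0 b] by simp

lemma le_add_left_ordinal [simp]: "b \<le> a + (b :: 'a::infinite ordinal)"
proof (induction b rule: less_induct)
  case (less b)
  show ?case
  proof (rule ccontr)
    assume "\<not> ?thesis"
    with less[of "a + b"] show False by (simp add: not_le)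
  qed
qed

lemma zero_add_ordinal [simp]: "0 + a = (a :: 'a::infinite ordinal)"
proof (induction a rule: less_induct)
  case (less a)
  show ?case
  proof (cases a rule: ordinal_cases)
    case limit
    have "0 + a \<le> a" using limit less by (auto simp: add_limit_le_iff)
    then show ?thesis by (simp add: eq_iff)
  qed (use less in \<open>auto simp: less_osuc\<close>)
qed

lemma ex_add_eq:
  assumes "a \<le> (b :: 'a::infinite ordinal)"
  shows "\<exists>c. a + c = b"
  using assms
proof (induction b rule: less_induct)
  case (less b)
  define c where "c = (LEAST c. b \<le> a + c)"
  have c: "b \<le> a + c" unfolding c_def by (rule LeastI[of _ b]) simp
  have least: "a + c' < b" if "c' < c" for c'
    using not_less_Least[of c' "\<lambda>c. b \<le> a + c"] that by (auto simp: c_def)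
  have "a + c \<le> b"
  proof (cases c rule: ordinal_cases)
    case (succ d)
    then show ?thesis using least[of d] by (simp add: less_osuc)
  next
    case limit
    then show ?thesis using least by (auto simp: add_limit_le_iff intro: less_imp_le)
  qed (use less in auto)
  with c have "a + c = b" by (rule order_antisym[rotated])
  then show ?case by blast
qed

text \<open>
  The case of a limit \<open>c\<close> in the associativity law needs the continuity of \<open>a + _\<close> at
  \<open>b + c\<close>, and hence that this is a limit.
\<close>

lemma is_limit_add: "is_limit b \<Longrightarrow> is_limit (a + (b :: 'a::infinite ordinal))"
proof -
  assume b: "is_limit b"
  have "\<not> is_succ (a + b)"
  proof
    assume "is_succ (a + b)"
    then obtain c where c: "a + b = osuc c" by (auto simp: is_succ_def)
    then have "c < a + b" by (simp add: less_osuc)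
    then obtain b' where "b' < b" "c < a + b'" using less_add_limit_iff[OF b] by blast
    then show False using c by (metis add_less_cancel_ordinal leD osuc_le_iff)
  qed
  moreover have "a + b \<noteq> 0"
    using zero_less_limit[OF b] le_add_left_ordinal[of b a] by (metis leD)
  ultimately show ?thesis by (simp add: is_limit_def)
qed

lemma add_assoc_ordinal: "a + b + c = a + (b + c :: 'a::infinite ordinal)"
proof (induction c rule: less_induct)
  case (less c)
  show ?case
  proof (cases c rule: ordinal_cases)
    case limit
    note bc = is_limit_add[OF limit, of b]
    have "a + b + c \<le> a + (b + c)"
      using limit less by (auto simp: add_limit_le_iff less_imp_le)
    moreover have "a + d \<le> a + b + c" if d: "d < b + c" for d
    proof -
      obtain c' where "c' < c" "d < b + c'"
        using d less_add_limit_iff[OF limit] by blast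
      then have "a + d < a + b + c'" using less by simp
      also have "\<dots> < a + b + c" using \<open>c' < c\<close> by simp
      finally show ?thesis by simp
    qed
    ultimately show ?thesis by (simp add: add_limit_le_iff[OF bc] eq_iff)
  qed (use less in \<open>auto simp: less_osuc\<close>)
qed

lemma add_left_mono_ordinal: "a \<le> b \<Longrightarrow> a + c \<le> b + (c :: 'a::infinite ordinal)"
proof -
  assume "a \<le> b"
  then obtain d where "a + d = b" using ex_add_eq by blast
  then show ?thesis by (auto simp: add_assoc_ordinal)
qed

lemma left_diff_add [simp]: "left_diff b (b + c) = (c :: 'a::infinite ordinal)"
  by (simp add: left_diff_def)

section \<open>Powers of omega\<close>

definition fin_ord :: "nat \<Rightarrow> 'a::infinite ordinal" where
  "fin_ord n = (osuc ^^ n) 0"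

lemma fin_ord_simps [simp]: "fin_ord 0 = 0" "fin_ord (Suc n) = osuc (fin_ord n)"
  by (simp_all add: fin_ord_def)

text \<open>
  The finite ordinals are bounded because the parameter type is infinite; their supremum is a limit.
\<close>

lemma ex_limit: "\<exists>l :: 'a::infinite ordinal. is_limit l"
proof -
  have "(card_of (range fin_ord :: 'a ordinal set), card_of (UNIV :: 'a set)) \<in> ordLeq"
    using infinite_iff_card_of_nat[of "UNIV :: 'a set"] infinite_UNIV
      ordLeq_transitive[OF card_of_image] by metis
  from ordinal_small_bounded[OF this]
  have ex: "\<exists>b :: 'a ordinal. \<forall>n. fin_ord n < b" by auto
  define l :: "'a ordinal" where "l = (LEAST b. \<forall>n. fin_ord n < b)"
  have l: "fin_ord n < l" for n
    using LeastI_ex[OF ex] by (auto simp: l_def)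
  have "\<not> is_succ l"
  proof
    assume "is_succ l"
    then obtain c where c: "l = osuc c" by (auto simp: is_succ_def)
    have "fin_ord n < c" for n
      using l[of "Suc n"] c by (simp only: fin_ord_simps osuc_less_iff)
    then have "l \<le> c" unfolding l_def by (auto intro: Least_le)
    with c show False by simp
  qed
  then have "is_limit l" using l[of 0] by (auto simp: is_limit_def)
  then show ?thesis by blast
qed

lemma is_limit_omega: "is_limit (omega :: 'a::infinite ordinal)"
  unfolding omega_def using ex_limit by (rule LeastI_ex)

lemma less_omega_iff: "(a :: 'a::infinite ordinal) < omega \<longleftrightarrow> (\<exists>n. a = fin_ord n)"
proof
  have "fin_ord n < (omega :: 'a ordinal)" for n
    by (induction n) (simp_all add: zero_less_limit osuc_less_limit is_limit_omega)
  then show "\<exists>n. a = fin_ord n \<Longrightarrow> a < omega" by blast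
next
  show "a < omega \<Longrightarrow> \<exists>n. a = fin_ord n"
  proof (induction a rule: less_induct)
    case (less a)
    show ?case
    proof (cases a rule: ordinal_cases)
      case zero
      then show ?thesis by (metis fin_ord_simps(1))
    next
      case (succ b)
      then have "b < omega" using less.prems less_osuc less_trans by blast
      then obtain n where "b = fin_ord n" using less.IH[of b] succ by (auto simp: less_osuc)
      then show ?thesis using succ by (metis fin_ord_simps(2))
    next
      case limit
      then show ?thesis using less.prems not_less_Least unfolding omega_def by blast
    qed
  qed
qed

lemma mult_ordinal_simps [simp]:
  fixes a :: "'a::infinite ordinal"
  shows "a * 0 = 0" "a * osuc b = a * b + a"
  by (simp_all add: times_ordinal_def)

lemma less_mult_omega_iff:
  "(c :: 'a::infinite ordinal) < a * omega \<longleftrightarrow> (\<exists>n. c < a * fin_ord n)"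
  unfolding times_ordinal_def by (auto simp: less_ord_rec_limit_iff is_limit_omega less_omega_iff)

lemma omega_pow_zero [simp]: "omega_pow 0 = osuc 0"
  by (simp add: omega_pow_def)

lemma omega_pow_osuc: "omega_pow (osuc b) = omega_pow b * omega"
  by (simp add: omega_pow_def)

lemma less_omega_pow_limit_iff:
  "is_limit b \<Longrightarrow> c < omega_pow b \<longleftrightarrow> (\<exists>b'<b. c < omega_pow b')"
  by (simp add: omega_pow_def less_ord_rec_limit_iff)

lemma omega_pow_pos [simp]: "0 < omega_pow (b :: 'a::infinite ordinal)"
proof (induction b rule: less_induct)
  case (less b)
  show ?case
  proof (cases b rule: ordinal_cases)
    case (succ c)
    have "0 < omega_pow c * fin_ord (Suc 0)" using less[of c] succ by (simp add: less_osuc)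
    then show ?thesis unfolding succ omega_pow_osuc less_mult_omega_iff by blast
  next
    case limit
    then show ?thesis
      using less[of 0] zero_less_limit[OF limit] less_omega_pow_limit_iff by blast
  qed (simp add: less_osuc)
qed

lemma less_mult_omega: "0 < a \<Longrightarrow> a < a * (omega :: 'a::infinite ordinal)"
proof -
  assume "0 < a"
  then have "a < a * fin_ord (Suc (Suc 0))"
    using add_less_cancel_ordinal[of a 0 a] by simp
  then show ?thesis using less_mult_omega_iff by blast
qed

lemma omega_pow_less_iff [simp]:
  "omega_pow a < omega_pow b \<longleftrightarrow> a < (b :: 'a::infinite ordinal)"
proof -
  have "omega_pow n < omega_pow n * omega" for n :: "'a ordinal"
    by (simp add: less_mult_omega)
  then have *: "omega_pow x < omega_pow y" if "x < y" for x y :: "'a ordinal"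
    using that ord_rec_strict_mono[of "osuc 0" "\<lambda>x. x * omega" x y]
    unfolding omega_pow_def by simp
  then show ?thesis by (metis less_irrefl less_linear less_trans)
qed

lemma omega_pow_le_iff [simp]:
  "omega_pow a \<le> omega_pow b \<longleftrightarrow> a \<le> (b :: 'a::infinite ordinal)"
  by (meson not_le omega_pow_less_iff)

lemma le_omega_pow [simp]: "a \<le> omega_pow (a :: 'a::infinite ordinal)"
proof (induction a rule: less_induct)
  case (less a)
  show ?case
  proof (rule ccontr)
    assume "\<not> ?thesis"
    with less[of "omega_pow a"] show False by (simp add: not_le)
  qed
qed

lemma mult_fin_ord_add:
  "a * fin_ord m + a * fin_ord n = (a * fin_ord (m + n) :: 'a::infinite ordinal)"
  by (induction n) (simp_all flip: add_assoc_ordinal)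

text \<open>
  Powers of \<open>\<omega>\<close> are additively indecomposable: below \<open>\<omega>\<^bsup>y + 1\<^esup>\<close> everything is bounded
  by finite multiples of \<open>\<omega>\<^sup>y\<close>, and at limits everything is bounded by smaller powers.
\<close>

lemma add_less_omega_pow:
  fixes a b :: "'a::infinite ordinal"
  assumes "a < omega_pow x" "b < omega_pow x"
  shows "a + b < omega_pow x"
  using assms
proof (induction x rule: less_induct)
  case (less x)
  show ?case
  proof (cases x rule: ordinal_cases)
    case zero
    then show ?thesis using less.prems by simp
  next
    case (succ y)
    obtain m n where mn: "a < omega_pow y * fin_ord m" "b < omega_pow y * fin_ord n"
      using less.prems unfolding succ omega_pow_osuc less_mult_omega_iff by blast
    have "a + b < a + omega_pow y * fin_ord n" using mn by simp
    also have "\<dots> \<le> omega_pow y * fin_ord m + omega_pow y * fin_ord n"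
      using mn by (intro add_left_mono_ordinal) simp
    finally show ?thesis
      unfolding succ omega_pow_osuc less_mult_omega_iff mult_fin_ord_add by blast
  next
    case limit
    obtain y z where yz: "y < x" "a < omega_pow y" "z < x" "b < omega_pow z"
      using less.prems limit less_omega_pow_limit_iff by blast
    define w where "w = max y z"
    have "omega_pow y \<le> omega_pow w" "omega_pow z \<le> omega_pow w" by (simp_all add: w_def)
    then have "a < omega_pow w" "b < omega_pow w"
      using yz(2,4) by (meson less_le_trans)+
    moreover have "w < x" using yz by (simp add: w_def)
    ultimately show ?thesis
      using less.IH[of w] omega_pow_less_iff[of w x] by (meson less_trans)
  qed
qed

text \<open>
  If \<open>\<omega>\<^sup>x\<close> were smaller than \<open>c + \<omega>\<^sup>x\<close>, then \<open>\<omega>\<^sup>x = c + d\<close> with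
  \<open>d < \<omega>\<^sup>x\<close>, against indecomposability.
\<close>

lemma add_omega_pow_absorb:
  fixes c :: "'a::infinite ordinal"
  assumes "c < omega_pow x"
  shows "c + omega_pow x = omega_pow x"
proof (rule ccontr)
  assume "c + omega_pow x \<noteq> omega_pow x"
  then have less: "omega_pow x < c + omega_pow x"
    using le_add_left_ordinal[of "omega_pow x" c] by (metis le_neq_trans)
  obtain d where d: "c + d = omega_pow x" using ex_add_eq assms less_imp_le by blast
  then have "d < omega_pow x" using less by (metis add_less_cancel_ordinal)
  then show False using add_less_omega_pow[OF assms] d by (metis less_irrefl)
qed

section \<open>Normal forms\<close>

lemma nf_val_simps [simp]:
  "nf_val [] = 0" "nf_val (x # xs) = omega_pow x + nf_val xs"
  by (simp_all add: nf_val_def)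

lemma nf_val_append: "nf_val (xs @ ys) = nf_val xs + nf_val ys"
  by (induction xs) (simp_all add: add_assoc_ordinal)

lemma nf_val_less_omega_pow:
  "(\<And>x. x \<in> set xs \<Longrightarrow> x < y) \<Longrightarrow> nf_val xs < omega_pow (y :: 'a::infinite ordinal)"
  by (induction xs) (simp_all add: add_less_omega_pow)

text \<open>
  Two decreasing lists are compared in the multiset order by their first difference, since the entries
  after a strictly larger one do not matter. The same holds for the values, because
  \<open>\<omega>\<^sup>y\<close> exceeds every sum of smaller powers.
\<close>

lemma nf_val_strict_mono:
  fixes xs ys :: "'a::infinite ordinal list"
  assumes "sorted_wrt (\<ge>) xs" "sorted_wrt (\<ge>) ys" "mset xs < mset ys"
  shows "nf_val xs < nf_val ys"
  using assms
proof (induction xs arbitrary: ys)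
  case Nil
  then obtain y ys' where "ys = y # ys'" by (cases ys) auto
  then show ?case using omega_pow_pos[of y] by (simp add: less_le_trans[OF _ le_add_ordinal])
next
  case (Cons x xs)
  then obtain y ys' where ys: "ys = y # ys'" by (cases ys) auto
  show ?case
  proof (cases x y rule: linorder_cases)
    case less
    then have "nf_val (x # xs) < omega_pow y"
      using Cons.prems(1) by (intro nf_val_less_omega_pow) auto
    then show ?thesis unfolding ys by (simp add: less_le_trans[OF _ le_add_ordinal])
  next
    case equal
    then show ?thesis using Cons ys by simp
  next
    case greater
    then have "\<forall>z\<in>set ys. z < x" using Cons.prems(2) ys by auto
    then have "mset ys < mset (x # xs)" by (intro ex_gt_imp_less_multiset) auto
    then show ?thesis using Cons.prems(3) by simp
  qed
qed

text \<open>
  The leading exponent of a nonzero \<open>a\<close> is the largest \<open>x\<close> with \<open>\<omega>\<^sup>x \<le> a\<close>, which exists by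
  continuity of \<open>omega_pow\<close>; the remainder is smaller than \<open>a\<close> because \<open>\<omega>\<^sup>x + a = a\<close> would
  force \<open>\<omega>\<^sup>x \<cdot> n \<le> a\<close> for all \<open>n\<close>.
\<close>

lemma ex_leading_exponent:
  fixes a :: "'a::infinite ordinal"
  assumes "a \<noteq> 0"
  obtains x c where "a = omega_pow x + c" "c < a" "a < omega_pow (osuc x)"
proof -
  define y where "y = (LEAST y. a < omega_pow y)"
  have "a < omega_pow (osuc a)"
    using le_omega_pow[of "osuc a"] less_osuc less_le_trans by blast
  then have y: "a < omega_pow y" unfolding y_def by (rule LeastI)
  have least: "omega_pow y' \<le> a" if "y' < y" for y'
    using not_less_Least[of y' "\<lambda>y. a < omega_pow y"] that by (auto simp: y_def)
  show thesis
  proof (cases y rule: ordinal_cases)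
    case zero
    then show thesis using assms y by simp
  next
    case limit
    then show thesis using y least less_omega_pow_limit_iff by (meson leD)
  next
    case (succ x)
    obtain c where c: "a = omega_pow x + c"
      using least[of x] succ ex_add_eq[of "omega_pow x" a] by (auto simp: less_osuc)
    have "c \<noteq> a"
    proof
      assume "c = a"
      with c have abs: "omega_pow x + a = a" by simp
      \<comment> \<open>Finite multiples commute, so that a summand may be split off on the left.\<close>
      have comm: "omega_pow x * fin_ord (Suc n) = omega_pow x + omega_pow x * fin_ord n" for n
        using mult_fin_ord_add[of "omega_pow x" 1 n] by simp
      have "omega_pow x * fin_ord n \<le> a" for n
      proof (induction n)
        case (Suc n)
        then show ?case unfolding comm by (metis abs add_le_cancel_ordinal)
      qed simp
      then show False
        using y unfolding succ omega_pow_osuc less_mult_omega_iff by (meson leD)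
    qed
    then have "c < a" using le_add_left_ordinal[of c "omega_pow x"] c by (metis le_neq_trans)
    then show thesis using that c y succ by blast
  qed
qed

lemma ex_normal_form:
  "\<exists>xs. sorted_wrt (\<ge>) xs \<and> nf_val xs = (a :: 'a::infinite ordinal)"
proof (induction a rule: less_induct)
  case (less a)
  show ?case
  proof (cases "a = 0")
    case True
    then show ?thesis by (intro exI[of _ "[]"]) simp
  next
    case False
    then obtain x c where xc: "a = omega_pow x + c" "c < a" "a < omega_pow (osuc x)"
      by (rule ex_leading_exponent)
    with less obtain xs where xs: "sorted_wrt (\<ge>) xs" "nf_val xs = c" by blast
    have "y \<le> x" if "y \<in> set xs" for y
    proof -
      obtain ys zs where "xs = ys @ y # zs" using \<open>y \<in> set xs\<close> by (meson split_list)
      then have "omega_pow y \<le> nf_val xs"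
        by (simp add: nf_val_append order_trans[OF le_add_ordinal le_add_left_ordinal])
      then have "omega_pow y < omega_pow (osuc x)" using xs xc by (meson le_less_trans less_trans)
      then show ?thesis by simp
    qed
    then show ?thesis using xs xc by (intro exI[of _ "x # xs"]) auto
  qed
qed

lemma rev_sort_decreasing: "sorted_wrt (\<ge>) xs \<Longrightarrow> rev (sort xs) = xs"
  using properties_for_sort[of "rev xs" xs] by (simp add: sorted_wrt_rev)

lemma nf_val_inject:
  fixes xs ys :: "'a::infinite ordinal list"
  assumes "sorted_wrt (\<ge>) xs" "sorted_wrt (\<ge>) ys" "nf_val xs = nf_val ys"
  shows "xs = ys"
proof -
  have "mset xs = mset ys"
    using assms nf_val_strict_mono[of xs ys] nf_val_strict_mono[of ys xs]
    by (metis less_irrefl linorder_neqE)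
  then have "sort xs = sort ys"
    by (metis sorted_list_of_multiset_mset)
  then show ?thesis using assms rev_sort_decreasing by metis
qed

lemma normal_form_nf_val [simp]:
  "sorted_wrt (\<ge>) xs \<Longrightarrow> normal_form (nf_val xs) = xs"
  unfolding normal_form_def by (rule the_equality) (auto intro: nf_val_inject)

lemma sorted_normal_form [simp]: "sorted_wrt (\<ge>) (normal_form (a :: 'a::infinite ordinal))"
  and nf_val_normal_form [simp]: "nf_val (normal_form a) = a"
  using ex_normal_form[of a] by auto

section \<open>The multiset of exponents\<close>

definition exps :: "'a::infinite ordinal \<Rightarrow> 'a ordinal multiset" where
  "exps a = mset (normal_form a)"

definition of_exps :: "'a::infinite ordinal multiset \<Rightarrow> 'a ordinal" where
  "of_exps M = nf_val (rev (sorted_list_of_multiset M))"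

lemma exps_nf_val: "sorted_wrt (\<ge>) xs \<Longrightarrow> exps (nf_val xs) = mset xs"
  by (simp add: exps_def)

lemma exps_of_exps [simp]: "exps (of_exps M) = M"
  by (simp add: of_exps_def exps_nf_val sorted_wrt_rev)

lemma of_exps_exps [simp]: "of_exps (exps a) = a"
  by (simp add: of_exps_def exps_def rev_sort_decreasing)

lemma exps_eq_iff [simp]: "exps a = exps b \<longleftrightarrow> a = b"
  by (metis of_exps_exps)

lemma exps_less_iff [simp]: "exps a < exps b \<longleftrightarrow> a < b"
proof -
  have *: "a < b" if "exps a < exps b" for a b :: "'a ordinal"
    using that nf_val_strict_mono[of "normal_form a" "normal_form b"] by (simp add: exps_def)
  show ?thesis
    using *[of a b] *[of b a] by (metis exps_eq_iff less_asym linorder_neqE)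
qed

lemma exps_le_iff [simp]: "exps a \<le> exps b \<longleftrightarrow> a \<le> b"
  by (simp add: le_less)

lemma exps_zero [simp]: "exps 0 = {#}"
  using exps_nf_val[of "[]"] by simp

lemma exps_eq_empty_iff [simp]: "exps a = {#} \<longleftrightarrow> a = 0"
  using exps_eq_iff[of a 0] by (simp del: exps_eq_iff)

lemma exps_omega_pow [simp]: "exps (omega_pow x) = {#x#}"
  using exps_nf_val[of "[x]"] by simp

lemma of_exps_le_iff [simp]: "of_exps M \<le> of_exps N \<longleftrightarrow> M \<le> N"
  using exps_le_iff[of "of_exps M" "of_exps N"] by simp

lemma less_omega_pow_iff: "a < omega_pow x \<longleftrightarrow> (\<forall>y\<in>#exps a. y < x)"
  using exps_less_iff[of a "omega_pow x"] by simp

lemma nf_val_add_absorb: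
  "sorted_wrt (\<ge>) xs \<Longrightarrow>
    nf_val xs + (omega_pow y + c) = nf_val (filter (\<lambda>x. y \<le> x) xs) + (omega_pow y + c)"
proof (induction xs)
  case (Cons x xs)
  show ?case
  proof (cases "y \<le> x")
    case True
    then show ?thesis using Cons by (simp add: add_assoc_ordinal)
  next
    case False
    then have small: "\<forall>z\<in>set (x # xs). z < y" using Cons.prems by auto
    then have "nf_val (x # xs) + omega_pow y = omega_pow y"
      by (intro add_omega_pow_absorb nf_val_less_omega_pow) blast
    moreover have "filter (\<lambda>x. y \<le> x) (x # xs) = []"
      unfolding filter_empty_conv using small by (auto simp: not_le)
    ultimately show ?thesis
      by (simp only: add_assoc_ordinal[symmetric] nf_val_simps zero_add_ordinal)
  qed
qed simp

text \<open>
  In \<open>a + b\<close> the leading power of \<open>b\<close> absorbs the summands of \<open>a\<close> with smaller exponents.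
\<close>

lemma exps_add:
  assumes "y \<in># exps b" "\<And>z. z \<in># exps b \<Longrightarrow> z \<le> y"
  shows "exps (a + b) = filter_mset (\<lambda>x. y \<le> x) (exps a) + exps b"
proof -
  define xs where "xs = normal_form a"
  obtain y' ys where b: "normal_form b = y' # ys"
    using assms(1) by (cases "normal_form b") (auto simp: exps_def)
  have "y' \<in># exps b" "\<forall>z\<in>#exps b. z \<le> y'"
    using sorted_normal_form[of b] by (auto simp: exps_def b)
  then have [simp]: "y' = y" using assms by (auto intro: order_antisym)
  have bval: "b = omega_pow y + nf_val ys"
    using nf_val_normal_form[of b] by (simp add: b)
  have "a + b = nf_val xs + (omega_pow y + nf_val ys)"
    by (simp add: xs_def flip: bval)
  also have "\<dots> = nf_val (filter (\<lambda>x. y \<le> x) xs) + (omega_pow y + nf_val ys)"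
    by (rule nf_val_add_absorb) (simp add: xs_def)
  also have "\<dots> = nf_val (filter (\<lambda>x. y \<le> x) xs @ normal_form b)"
    by (simp add: nf_val_append b)
  finally have "exps (a + b) = mset (filter (\<lambda>x. y \<le> x) xs @ normal_form b)"
  proof (simp only:, intro exps_nf_val)
    show "sorted_wrt (\<ge>) (filter (\<lambda>x. y \<le> x) xs @ normal_form b)"
      using sorted_normal_form[of b] sorted_normal_form[of a]
      by (auto simp: sorted_wrt_append xs_def b sorted_wrt_filter)
  qed
  then show ?thesis by (simp add: exps_def xs_def)
qed

lemma exps_leading:
  assumes "b \<noteq> 0"
  obtains y where "y \<in># exps b" "\<And>z. z \<in># exps b \<Longrightarrow> z \<le> y"
proof -
  have "set_mset (exps b) \<noteq> {}" using assms by simp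
  then show thesis using that[of "Max (set_mset (exps b))"] by simp
qed

lemma exps_add_decreasing:
  assumes "\<And>x y. x \<in># exps a \<Longrightarrow> y \<in># exps b \<Longrightarrow> y \<le> x"
  shows "exps (a + b) = exps a + exps b"
proof (cases "b = 0")
  case False
  then obtain y where y: "y \<in># exps b" "\<And>z. z \<in># exps b \<Longrightarrow> z \<le> y"
    using exps_leading by blast
  then have "filter_mset (\<lambda>x. y \<le> x) (exps a) = exps a"
    using assms by (simp add: filter_mset_eq_conv)
  then show ?thesis using exps_add[OF y] by simp
qed simp

lemma exps_add_le: "exps (a + b) \<le> exps a + exps b"
proof (cases "b = 0")
  case False
  then obtain y where y: "y \<in># exps b" "\<And>z. z \<in># exps b \<Longrightarrow> z \<le> y"
    using exps_leading by blast
  show ?thesis using exps_add[OF y]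
    by (simp add: subset_eq_imp_le_multiset)
qed simp

lemma exps_osuc: "exps (osuc a) = add_mset 0 (exps a)"
proof -
  have "exps (a + omega_pow 0) = exps a + exps (omega_pow 0)"
    by (rule exps_add_decreasing) (simp del: omega_pow_zero)
  then show ?thesis using exps_omega_pow[of 0] by simp
qed

lemma exps_nat_sum [simp]: "exps (a \<sharp> b) = exps a + exps b"
  unfolding nat_sum_def by (subst exps_nf_val) (simp_all add: sorted_wrt_rev exps_def)

lemma exps_nat_sum_list: "exps (nat_sum_list xs) = sum_list (map exps xs)"
  by (induction xs) (simp_all add: nat_sum_list_def)

lemma nat_sum_one: "a \<sharp> osuc 0 = osuc a"
  by (subst exps_eq_iff[symmetric]) (simp add: exps_osuc)

text \<open>
  The factor \<open>\<omega>\<close> has the single exponent \<open>1\<close>, so that \<open>a \<otimes> \<omega>\<close> replaces each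
  exponent \<open>\<xi>\<close> of \<open>a\<close> by \<open>\<xi> \<sharp> 1\<close>, which is the successor of \<open>\<xi>\<close>.
\<close>

lemma omega_eq: "omega = (omega_pow (osuc 0) :: 'a::infinite ordinal)"
proof -
  have "osuc 0 * fin_ord n = (fin_ord n :: 'a ordinal)" for n
    by (induction n) simp_all
  then have "c < osuc 0 * omega \<longleftrightarrow> c < omega" for c :: "'a ordinal"
    unfolding less_mult_omega_iff
    using less_osuc fin_ord_simps(2) less_omega_iff less_trans by metis
  then show ?thesis unfolding omega_pow_osuc omega_pow_zero by (metis less_irrefl linorder_neqE)
qed

lemma exps_nat_prod_omega [simp]: "exps (a \<otimes> omega) = image_mset osuc (exps a)"
proof -
  have "normal_form omega = [osuc (0 :: 'a ordinal)]"
    using normal_form_nf_val[of "[osuc (0 :: 'a ordinal)]"] by (simp add: omega_eq)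
  then have "exps (a \<otimes> omega) = (\<Sum>x\<leftarrow>normal_form a. {#osuc x#})"
    by (simp add: nat_prod_def exps_nat_sum_list nat_sum_one comp_def map_concat)
  also have "(\<Sum>x\<leftarrow>xs. {#osuc x#}) = image_mset osuc (mset xs)" for xs :: "'a ordinal list"
    by (induction xs) simp_all
  finally show ?thesis by (simp add: exps_def)
qed

lemma drop_last_summand:
  fixes a :: "'a::infinite ordinal"
  assumes "a \<noteq> 0"
  shows exps_drop_last: "exps a = add_mset (last_exponent a) (exps (drop_last_summand a))"
    and last_exponent_le: "\<And>x. x \<in># exps (drop_last_summand a) \<Longrightarrow> last_exponent a \<le> x"
    and drop_last_add: "drop_last_summand a + omega_pow (last_exponent a) = a"
proof -
  have "normal_form a \<noteq> []" using assms exps_eq_empty_iff[of a] by (auto simp: exps_def)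
  then have nf: "normal_form a = butlast (normal_form a) @ [last_exponent a]"
    by (simp add: last_exponent_def)
  then have sorted: "sorted_wrt (\<ge>) (butlast (normal_form a) @ [last_exponent a])"
    by (metis sorted_normal_form)
  have d: "exps (drop_last_summand a) = mset (butlast (normal_form a))"
    using sorted unfolding drop_last_summand_def
    by (intro exps_nf_val) (simp add: sorted_wrt_append)
  have "exps a = mset (butlast (normal_form a) @ [last_exponent a])"
    using nf by (simp add: exps_def)
  with d show 1: "exps a = add_mset (last_exponent a) (exps (drop_last_summand a))" by simp
  show 2: "last_exponent a \<le> x" if "x \<in># exps (drop_last_summand a)" for x
    using that sorted by (simp add: d sorted_wrt_append)
  have "exps (drop_last_summand a + omega_pow (last_exponent a)) = exps a"
    using 1 2 by (subst exps_add_decreasing) auto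
  then show "drop_last_summand a + omega_pow (last_exponent a) = a" by simp
qed

section \<open>Multisets of ordinals\<close>

text \<open>
  With \<open>x\<close> minimal, \<open>M\<close> extended by \<open>x\<close> represents the ordinal sum \<open>m + \<omega>\<^sup>x\<close>, where
  \<open>m\<close> represents \<open>M\<close>. An ordinal between \<open>m\<close> and this sum is \<open>m + d\<close> with
  \<open>d < \<omega>\<^sup>x\<close>.
\<close>

lemma less_add_min_cases:
  fixes M :: "'a::infinite ordinal multiset"
  assumes "G < add_mset x M" "\<And>y. y \<in># M \<Longrightarrow> x \<le> y"
  obtains N where "\<And>y. y \<in># N \<Longrightarrow> y < x" "G \<le> M + N"
proof (cases "G \<le> M")
  case True
  then show thesis using that[of "{#}"] by simp
next
  case False
  then have "of_exps M \<le> of_exps G" by auto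
  then obtain d where d: "of_exps M + d = of_exps G" using ex_add_eq by blast
  have "exps (of_exps M + omega_pow x) = add_mset x M"
    using assms(2) by (subst exps_add_decreasing) auto
  then have "of_exps M + d < of_exps M + omega_pow x"
    using assms(1) d by (metis exps_less_iff exps_of_exps)
  then have "\<forall>y\<in>#exps d. y < x" by (simp add: less_omega_pow_iff)
  moreover have "G \<le> M + exps d"
    using exps_add_le[of "of_exps M" d] d by simp
  ultimately show thesis using that by blast
qed

text \<open>
  It suffices to decrease the smallest element of \<open>A + B\<close>, and this can be done in the summand
  that contains it.
\<close>

lemma less_plus_cases:
  fixes A B :: "'a::infinite ordinal multiset"
  assumes "G < A + B"
  obtains A' where "A' < A" "G \<le> A' + B" | B' where "B' < B" "G \<le> A + B'"
proof -
  have ne: "set_mset (A + B) \<noteq> {}" using assms by auto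
  define x where "x = Min (set_mset (A + B))"
  have x: "x \<in># A + B" unfolding x_def using ne by (intro Min_in) auto
  have least: "x \<le> y" if "y \<in># A + B" for y
    unfolding x_def using that by (intro Min_le) auto
  have *: "\<exists>A'<A. G \<le> A' + B"
    if G: "G < A + B" and xA: "x \<in># A" and least: "\<And>y. y \<in># A + B \<Longrightarrow> x \<le> y"
    for A B :: "'a ordinal multiset"
  proof -
    obtain A0 where A0: "A = add_mset x A0" using xA by (rule mset_add)
    obtain N where N: "\<And>y. y \<in># N \<Longrightarrow> y < x" "G \<le> A0 + B + N"
      by (rule less_add_min_cases[of G x "A0 + B"]) (use G least A0 in auto)
    have "A0 + N < A0 + {#x#}" using N by (intro add_strict_left_mono) simp
    then show ?thesis using N A0 by (intro exI[of _ "A0 + N"]) (simp add: ac_simps)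
  qed
  from x consider "x \<in># A" | "x \<in># B" by auto
  then show thesis
  proof cases
    case 1
    then show thesis using *[OF assms 1 least] that(1) by blast
  next
    case 2
    then show thesis using *[of B A] assms least that(2) by (auto simp: ac_simps)
  qed
qed

lemma less_plus_sum_cases:
  fixes A :: "'a::infinite ordinal multiset"
  assumes "finite I" "G < A + (\<Sum>i\<in>I. C i)"
  obtains A' where "A' < A" "G \<le> A' + (\<Sum>i\<in>I. C i)"
    | j C' where "j \<in> I" "C' < C j" "G \<le> A + C' + (\<Sum>i\<in>I - {j}. C i)"
proof -
  have "(\<exists>A'<A. G \<le> A' + (\<Sum>i\<in>I. C i)) \<or>
      (\<exists>j\<in>I. \<exists>C'<C j. G \<le> A + C' + (\<Sum>i\<in>I - {j}. C i))"
    using assms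
  proof (induction I arbitrary: G rule: finite_induct)
    case (insert k I)
    from insert.prems insert.hyps have "G < C k + (A + (\<Sum>i\<in>I. C i))" by (simp add: ac_simps)
    then show ?case
    proof (cases rule: less_plus_cases)
      case (1 C')
      then show ?thesis using insert.hyps by (auto simp: ac_simps intro!: exI[of _ C'])
    next
      case (2 R)
      from insert.IH[OF this(1)] show ?thesis
      proof (elim disjE exE bexE conjE)
        fix A' assume "A' < A" "R \<le> A' + (\<Sum>i\<in>I. C i)"
        moreover have "G \<le> C k + (A' + (\<Sum>i\<in>I. C i))"
          using 2(2) calculation(2) by (meson add_left_mono order_trans)
        ultimately show ?thesis using insert.hyps by (auto simp: ac_simps)
      next
        fix j C' assume j: "j \<in> I" "C' < C j" "R \<le> A + C' + (\<Sum>i\<in>I - {j}. C i)"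
        have "G \<le> C k + (A + C' + (\<Sum>i\<in>I - {j}. C i))"
          using 2(2) j(3) by (meson add_left_mono order_trans)
        moreover have "insert k I - {j} = insert k (I - {j})" using j(1) insert.hyps by auto
        ultimately have "G \<le> A + C' + (\<Sum>i\<in>insert k I - {j}. C i)"
          using insert.hyps by (simp add: ac_simps)
        then show ?thesis using j by blast
      qed
    qed
  qed auto
  then show thesis using that by blast
qed

lemma le_replicate_mset:
  fixes x :: "'a::linorder"
  shows "(\<And>y. y \<in># N \<Longrightarrow> y \<le> x) \<Longrightarrow> N \<le> replicate_mset (size N) x"
  by (induction N) (auto intro: add_mset_le_le_le)

section \<open>Excess over a threshold\<close>

text \<open>
  These are the exponents of the left difference, truncated to the empty multiset for \<open>a < z\<close>; the
  truncation makes \<open>excess z\<close> monotone on all ordinals and lets sums of excesses range over any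
  sufficiently large finite set of indices.
\<close>

definition excess :: "'a::infinite ordinal \<Rightarrow> 'a ordinal \<Rightarrow> 'a ordinal multiset" where
  "excess z a = (if z \<le> a then exps (left_diff z a) else {#})"

lemma excess_add [simp]: "excess z (z + c) = exps c"
  by (simp add: excess_def)

lemma excess_eq_empty [simp]: "a \<le> z \<Longrightarrow> excess z a = {#}"
  using excess_add[of z 0] by (cases "a = z") (simp_all add: excess_def)

lemma excess_cases:
  obtains "a \<le> z" "excess z a = {#}" | c where "c \<noteq> 0" "a = z + c" "excess z a = exps c"
proof (cases "a \<le> z")
  case False
  then obtain c where "a = z + c" using ex_add_eq[of z a] by (metis le_cases)
  then show thesis using that(2)[of c] False by (cases "c = 0") auto
qed (use that in auto)

lemma le_add_of_exps_excess: "a \<le> z + of_exps (excess z a)"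
  by (cases z a rule: excess_cases) (auto intro: order_trans)

text \<open>
  Left subtraction is adjoint to addition; monotonicity in \<open>a\<close> and antimonotonicity in \<open>z\<close> follow
  from this.
\<close>

lemma excess_le_iff: "excess z a \<le> M \<longleftrightarrow> a \<le> z + of_exps M"
proof (cases z a rule: excess_cases)
  case 1
  then show ?thesis using order_trans[OF _ le_add_ordinal] by auto
next
  case (2 c)
  then show ?thesis using exps_le_iff[of c "of_exps M"] by simp
qed

lemma excess_mono: "a \<le> b \<Longrightarrow> excess z a \<le> excess z b"
  using le_add_of_exps_excess[of b z] by (simp add: excess_le_iff)

lemma excess_strict_mono: "a < b \<Longrightarrow> z < b \<Longrightarrow> excess z a < excess z b"
  by (cases z b rule: excess_cases; cases z a rule: excess_cases) auto

lemma excess_antimono: "z \<le> z' \<Longrightarrow> excess z' a \<le> excess z a"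
  unfolding excess_le_iff[of z' a]
  by (rule order_trans[OF le_add_of_exps_excess add_left_mono_ordinal])

text \<open>
  If \<open>b\<close> is at most \<open>z' + e\<close> and \<open>z'\<close> is at most \<open>z + d\<close>, then \<open>a\<close> is at most
  \<open>z + (d + e)\<close>, and an ordinal sum never exceeds the natural sum.
\<close>

lemma excess_triangle:
  assumes "a \<le> b"
  shows "excess z a \<le> excess z z' + excess z' b"
proof -
  define d e where "d = of_exps (excess z z')" and "e = of_exps (excess z' b)"
  have "a \<le> z' + e" unfolding e_def using assms le_add_of_exps_excess order_trans by blast
  also have "\<dots> \<le> z + d + e"
    unfolding d_def by (rule add_left_mono_ordinal) (rule le_add_of_exps_excess)
  also have "\<dots> \<le> z + of_exps (exps d + exps e)"
    using exps_add_le[of d e] exps_le_iff[of "d + e" "of_exps (exps d + exps e)"]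
    by (simp add: add_assoc_ordinal)
  finally show ?thesis by (simp add: excess_le_iff d_def e_def)
qed

lemma excess_less_omega_pow:
  assumes "a < z + omega_pow x" "y \<in># excess z a"
  shows "y < x"
proof (cases z a rule: excess_cases)
  case (2 c)
  then show ?thesis using assms by (simp add: less_omega_pow_iff)
qed (use assms in auto)

section \<open>The thresholds\<close>

lemma ex_upper_bound_sequence:
  fixes \<alpha> :: "nat \<Rightarrow> 'a::infinite ordinal"
  shows "\<exists>b. \<forall>i. \<alpha> i < b"
proof -
  have "(card_of (range \<alpha>), card_of (UNIV :: 'a set)) \<in> ordLeq"
    using infinite_iff_card_of_nat[of "UNIV :: 'a set"] infinite_UNIV
      ordLeq_transitive[OF card_of_image] by metis
  from ordinal_small_bounded[OF this] show ?thesis by auto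
qed

lemma finite_above_zeta [simp]:
  fixes \<alpha> :: "nat \<Rightarrow> 'a::infinite ordinal"
  shows "finite {i. zeta \<alpha> < \<alpha> i}"
  unfolding zeta_def
proof (rule LeastI_ex)
  obtain b where "\<forall>i. \<alpha> i < b" using ex_upper_bound_sequence by blast
  then have "{i. b < \<alpha> i} = {}" by (auto dest: less_asym)
  then show "\<exists>z. finite {i. z < \<alpha> i}" by (metis finite.emptyI)
qed

lemma zeta_le: "finite {i. z < \<alpha> i} \<Longrightarrow> zeta \<alpha> \<le> z"
  unfolding zeta_def by (rule Least_le)

lemma infinite_above: "z < zeta \<alpha> \<Longrightarrow> infinite {i. z < \<alpha> i}"
  using zeta_le leD by blast

lemma zeta_eqI:
  fixes \<alpha> :: "nat \<Rightarrow> 'a::infinite ordinal"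
  assumes "finite {i. z < \<alpha> i}" "\<And>z'. z' < z \<Longrightarrow> infinite {i. z' < \<alpha> i}"
  shows "zeta \<alpha> = z"
  by (metis assms finite_above_zeta leD linorder_cases zeta_le)

lemma zeta_mono:
  fixes \<alpha> \<beta> :: "nat \<Rightarrow> 'a::infinite ordinal"
  assumes "\<And>i. \<alpha> i \<le> \<beta> i"
  shows "zeta \<alpha> \<le> zeta \<beta>"
proof (rule zeta_le)
  have "{i. zeta \<beta> < \<alpha> i} \<subseteq> {i. zeta \<beta> < \<beta> i}"
    using assms less_le_trans by blast
  then show "finite {i. zeta \<beta> < \<alpha> i}" using finite_above_zeta finite_subset by blast
qed

text \<open>
  The threshold \<open>eps \<alpha>\<close> is \<open>zeta \<alpha>\<close> if only finitely many elements reach \<open>zeta \<alpha>\<close>, and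
  its successor otherwise.
\<close>

lemma e_special_eq:
  fixes \<alpha> :: "nat \<Rightarrow> 'a::infinite ordinal"
  shows "e_special \<alpha> =
    (if finite {i. zeta \<alpha> \<le> \<alpha> i} then {i. zeta \<alpha> \<le> \<alpha> i} else {i. zeta \<alpha> < \<alpha> i})"
proof -
  have low: "infinite {i. e \<le> \<alpha> i}" if "e < zeta \<alpha>" for e
  proof -
    have "{i. e < \<alpha> i} \<subseteq> {i. e \<le> \<alpha> i}" by auto
    then show ?thesis using infinite_above[OF that] finite_subset by blast
  qed
  show ?thesis
  proof (cases "finite {i. zeta \<alpha> \<le> \<alpha> i}")
    case True
    then have "eps \<alpha> = zeta \<alpha>"
      unfolding eps_def by (intro Least_equality) (use low not_le in blast)+
    then show ?thesis using True by (simp add: e_special_def)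
  next
    case False
    have "eps \<alpha> = osuc (zeta \<alpha>)"
      unfolding eps_def
    proof (rule Least_equality)
      fix e assume e: "finite {i. e \<le> \<alpha> i}"
      have "e \<noteq> zeta \<alpha>" using e False by auto
      then show "osuc (zeta \<alpha>) \<le> e" using low[of e] e by force
    qed simp
    then show ?thesis using False by (simp add: e_special_def)
  qed
qed

lemma finite_e_special [simp]: "finite (e_special (\<alpha> :: nat \<Rightarrow> 'a::infinite ordinal))"
  by (simp add: e_special_eq)

section \<open>Exponents of the infinitary sum\<close>

definition limit_case :: "(nat \<Rightarrow> 'a::infinite ordinal) \<Rightarrow> bool" where
  "limit_case \<alpha> \<longleftrightarrow>
    zeta \<alpha> \<noteq> 0 \<and> is_limit (last_exponent (zeta \<alpha>)) \<and> finite {i. zeta \<alpha> \<le> \<alpha> i}"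

lemma exps_S_sum_limit:
  fixes \<alpha> :: "nat \<Rightarrow> 'a::infinite ordinal"
  assumes "limit_case \<alpha>"
  defines "z \<equiv> drop_last_summand (zeta \<alpha>)"
  shows "exps (S_sum \<alpha>) = image_mset osuc (exps z) + {#last_exponent (zeta \<alpha>)#}
    + (\<Sum>i\<in>{i. zeta \<alpha> \<le> \<alpha> i}. excess z (\<alpha> i))"
proof -
  note a = assms(1)[unfolded limit_case_def]
  have "z \<le> zeta \<alpha>"
    using drop_last_add[of "zeta \<alpha>"] a le_add_ordinal unfolding z_def by metis
  then have "(\<Sum>i\<in>{i. zeta \<alpha> \<le> \<alpha> i}. excess z (\<alpha> i)) =
      (\<Sum>i\<in>{i. zeta \<alpha> \<le> \<alpha> i}. exps (left_diff z (\<alpha> i)))"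
    by (intro sum.cong) (auto simp: excess_def)
  then show ?thesis
    using a by (simp add: S_sum_def Let_def z_def e_special_eq exps_nat_sum_list
        sum_list_distinct_conv_sum_set comp_def)
qed

text \<open>
  The definition sums over the e-special elements; those that are not z-special equal the threshold
  and have an empty excess.
\<close>

lemma exps_S_sum_not_limit:
  fixes \<alpha> :: "nat \<Rightarrow> 'a::infinite ordinal"
  assumes "\<not> limit_case \<alpha>"
  shows "exps (S_sum \<alpha>) = image_mset osuc (exps (zeta \<alpha>))
    + (\<Sum>i\<in>{i. zeta \<alpha> < \<alpha> i}. excess (zeta \<alpha>) (\<alpha> i))"
proof -
  have "(\<Sum>i\<in>{i. zeta \<alpha> < \<alpha> i}. excess (zeta \<alpha>) (\<alpha> i)) =
      (\<Sum>i\<in>e_special \<alpha>. excess (zeta \<alpha>) (\<alpha> i))"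
    by (intro sum.mono_neutral_left) (auto simp: e_special_eq not_less)
  also have "\<dots> = (\<Sum>i\<in>e_special \<alpha>. exps (left_diff (zeta \<alpha>) (\<alpha> i)))"
    by (intro sum.cong) (auto simp: excess_def e_special_eq split: if_splits)
  finally show ?thesis
    using assms unfolding limit_case_def
    by (auto simp: S_sum_def Let_def exps_nat_sum_list sum_list_distinct_conv_sum_set comp_def)
qed

section \<open>Monotonicity\<close>

text \<open>
  The formula valid outside the limit case, evaluated for every sequence. In the limit case it
  strictly exceeds the sum, so that it serves as a uniform upper bound.
\<close>

definition bound_exps :: "(nat \<Rightarrow> 'a::infinite ordinal) \<Rightarrow> 'a ordinal multiset" where
  "bound_exps \<alpha> = image_mset osuc (exps (zeta \<alpha>))
    + (\<Sum>i\<in>{i. zeta \<alpha> < \<alpha> i}. excess (zeta \<alpha>) (\<alpha> i))"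

lemma bound_exps_superset:
  fixes \<alpha> :: "nat \<Rightarrow> 'a::infinite ordinal"
  assumes "finite J" "{i. zeta \<alpha> < \<alpha> i} \<subseteq> J"
  shows "bound_exps \<alpha> = image_mset osuc (exps (zeta \<alpha>)) + (\<Sum>i\<in>J. excess (zeta \<alpha>) (\<alpha> i))"
  unfolding bound_exps_def
  by (intro arg_cong2[where f = "(+)"] sum.mono_neutral_left refl) (use assms in \<open>auto simp: not_less\<close>)

lemma excess_drop_last:
  "z \<noteq> 0 \<Longrightarrow> excess (drop_last_summand z) z = {#last_exponent z#}"
  by (metis drop_last_add excess_add exps_omega_pow)

text \<open>
  Let \<open>\<omega>\<^sup>x\<close> be the last summand of the threshold. Each of the finitely many elements reaching
  the threshold contributes at most one more copy of \<open>\<omega>\<^sup>x\<close> than in the formula of the other case. All these copies together stay below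
  \<open>\<omega>\<^bsup>x + 1\<^esup>\<close>, which that formula has in place of a single \<open>\<omega>\<^sup>x\<close>.
\<close>

lemma exps_S_sum_less_bound:
  fixes \<alpha> :: "nat \<Rightarrow> 'a::infinite ordinal"
  assumes "limit_case \<alpha>"
  shows "exps (S_sum \<alpha>) < bound_exps \<alpha>"
proof -
  define z where "z = drop_last_summand (zeta \<alpha>)"
  define x where "x = last_exponent (zeta \<alpha>)"
  define E where "E = {i. zeta \<alpha> \<le> \<alpha> i}"
  have E: "finite E" "zeta \<alpha> \<noteq> 0" using assms by (auto simp: limit_case_def E_def)
  have zx: "excess z (zeta \<alpha>) = {#x#}" "exps (zeta \<alpha>) = add_mset x (exps z)"
    using excess_drop_last[OF E(2)] exps_drop_last[OF E(2)] by (simp_all add: z_def x_def)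
  have "(\<Sum>i\<in>E. excess z (\<alpha> i)) \<le> (\<Sum>i\<in>E. {#x#} + excess (zeta \<alpha>) (\<alpha> i))"
    using excess_triangle[of _ _ z "zeta \<alpha>"] zx(1) by (intro sum_mono) (metis order_refl)
  then have "exps (S_sum \<alpha>) \<le>
      image_mset osuc (exps z) + {#x#} + (\<Sum>i\<in>E. {#x#} + excess (zeta \<alpha>) (\<alpha> i))"
    unfolding exps_S_sum_limit[OF assms] z_def[symmetric] x_def[symmetric] E_def[symmetric]
    by (rule add_left_mono)
  also have "\<dots> = ({#x#} + (\<Sum>i\<in>E. {#x#}))
      + (image_mset osuc (exps z) + (\<Sum>i\<in>E. excess (zeta \<alpha>) (\<alpha> i)))"
    by (simp only: sum.distrib ac_simps)
  also have "\<dots> < {#osuc x#}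
      + (image_mset osuc (exps z) + (\<Sum>i\<in>E. excess (zeta \<alpha>) (\<alpha> i)))"
    using E(1) by (intro add_strict_right_mono) (auto simp: set_mset_sum)
  also have "\<dots> = bound_exps \<alpha>"
    by (subst bound_exps_superset[of E]) (use E in \<open>auto simp: E_def zx\<close>)
  finally show ?thesis .
qed

lemma exps_S_sum_le_bound: "exps (S_sum \<alpha>) \<le> bound_exps \<alpha>"
  using exps_S_sum_less_bound[of \<alpha>] exps_S_sum_not_limit[of \<alpha>]
  by (cases "limit_case \<alpha>") (auto simp: bound_exps_def)

text \<open>
  With \<open>z' = z + d\<close> and \<open>y\<close> the leading exponent of \<open>d\<close>, the exponents of \<open>z\<close> that
  are at least \<open>y\<close> occur on both sides. All that remains on the left is at most \<open>y\<close>, while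
  \<open>y + 1\<close> remains on the right.
\<close>

lemma osuc_exps_less:
  fixes z z' :: "'a::infinite ordinal"
  assumes "z < z'" "finite J"
  shows "image_mset osuc (exps z) + (\<Sum>i\<in>J. excess z z') < image_mset osuc (exps z')"
proof -
  obtain d where d: "z' = z + d" "d \<noteq> 0" "excess z z' = exps d"
    using assms(1) by (cases z z' rule: excess_cases) auto
  then obtain y where y: "y \<in># exps d" "\<And>x. x \<in># exps d \<Longrightarrow> x \<le> y"
    using exps_leading by blast
  define A B where "A = filter_mset (\<lambda>x. y \<le> x) (exps z)"
    and "B = filter_mset (\<lambda>x. \<not> y \<le> x) (exps z)"
  have z: "exps z = A + B" unfolding A_def B_def by (rule multiset_partition)
  have z': "exps z' = A + exps d" unfolding d(1) A_def by (rule exps_add[OF y])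
  have "image_mset osuc B + (\<Sum>i\<in>J. exps d) < image_mset osuc (exps d)"
  proof (rule ex_gt_imp_less_multiset, intro exI[of _ "osuc y"] conjI allI impI)
    fix x assume "x \<in># image_mset osuc B + (\<Sum>i\<in>J. exps d)"
    then show "x < osuc y"
      using y(2) assms(2) by (auto simp: B_def set_mset_sum not_le split: if_splits)
  qed (use y in simp)
  then show ?thesis by (simp add: z z' d(3) add.assoc)
qed

text \<open>
  Outside the limit case the gain in \<open>\<zeta> \<otimes> \<omega>\<close> outweighs the differences between the two
  thresholds. In the limit case write \<open>zeta \<beta> = z + \<omega>\<^sup>x\<close>. Either the smaller threshold is at
  most \<open>z\<close> and the same argument applies with \<open>z\<close> as the larger threshold, or it is
  \<open>z + r\<close> with \<open>r < \<omega>\<^sup>x\<close>; then \<open>r \<otimes> \<omega>\<close> still has exponents below \<open>x\<close> because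
  \<open>x\<close> is a limit. The remaining summands without a counterpart come from elements below
  \<open>zeta \<beta>\<close>, so that their exponents are below \<open>x\<close> and \<open>\<omega>\<^sup>x\<close> outweighs them.
\<close>

lemma S_sum_less_if_zeta_less:
  fixes \<alpha> \<beta> :: "nat \<Rightarrow> 'a::infinite ordinal"
  assumes le: "\<And>i. \<alpha> i \<le> \<beta> i" and less: "zeta \<alpha> < zeta \<beta>"
  shows "S_sum \<alpha> < S_sum \<beta>"
proof (cases "limit_case \<beta>")
  case False
  define J where "J = {i. zeta \<alpha> < \<alpha> i} \<union> {i. zeta \<beta> < \<beta> i}"
  have J: "finite J" by (simp add: J_def)
  have "exps (S_sum \<alpha>) \<le> image_mset osuc (exps (zeta \<alpha>)) + (\<Sum>i\<in>J. excess (zeta \<alpha>) (\<alpha> i))"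
    using exps_S_sum_le_bound[of \<alpha>] bound_exps_superset[OF J, of \<alpha>] by (simp add: J_def)
  also have "\<dots> \<le> image_mset osuc (exps (zeta \<alpha>))
      + (\<Sum>i\<in>J. excess (zeta \<alpha>) (zeta \<beta>) + excess (zeta \<beta>) (\<beta> i))"
    by (intro add_left_mono sum_mono excess_triangle le)
  also have "\<dots> = image_mset osuc (exps (zeta \<alpha>)) + (\<Sum>i\<in>J. excess (zeta \<alpha>) (zeta \<beta>))
      + (\<Sum>i\<in>J. excess (zeta \<beta>) (\<beta> i))"
    by (simp only: sum.distrib add.assoc)
  also have "\<dots> < image_mset osuc (exps (zeta \<beta>)) + (\<Sum>i\<in>J. excess (zeta \<beta>) (\<beta> i))"
    by (intro add_strict_right_mono osuc_exps_less less J)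
  also have "\<dots> = exps (S_sum \<beta>)"
    unfolding exps_S_sum_not_limit[OF False] bound_exps_def[symmetric]
    by (rule bound_exps_superset[symmetric]) (simp_all add: J_def)
  finally show ?thesis by simp
next
  case True
  define z where "z = drop_last_summand (zeta \<beta>)"
  define x where "x = last_exponent (zeta \<beta>)"
  define E where "E = {i. zeta \<beta> \<le> \<beta> i}"
  define J where "J = {i. zeta \<alpha> < \<alpha> i} \<union> E"
  have E: "finite E" "zeta \<beta> \<noteq> 0" "is_limit x"
    using True by (auto simp: limit_case_def E_def x_def)
  have J: "finite J" using E by (simp add: J_def)
  have zx: "zeta \<beta> = z + omega_pow x" "\<And>y. y \<in># exps z \<Longrightarrow> x \<le> y"
    using drop_last_add[OF E(2)] last_exponent_le[OF E(2)] by (simp_all add: z_def x_def)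
  have "\<exists>X. (\<forall>y\<in>#X. y < x) \<and>
    image_mset osuc (exps (zeta \<alpha>)) + (\<Sum>i\<in>J. excess (zeta \<alpha>) (\<alpha> i))
      \<le> image_mset osuc (exps z) + X + (\<Sum>i\<in>J. excess z (\<beta> i))"
  proof (cases "zeta \<alpha>" z rule: linorder_cases)
    case less
    have "image_mset osuc (exps (zeta \<alpha>)) + (\<Sum>i\<in>J. excess (zeta \<alpha>) (\<alpha> i))
        \<le> image_mset osuc (exps (zeta \<alpha>)) + (\<Sum>i\<in>J. excess (zeta \<alpha>) z + excess z (\<beta> i))"
      by (intro add_left_mono sum_mono excess_triangle le)
    also have "\<dots> = image_mset osuc (exps (zeta \<alpha>)) + (\<Sum>i\<in>J. excess (zeta \<alpha>) z)
        + (\<Sum>i\<in>J. excess z (\<beta> i))"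
      by (simp only: sum.distrib add.assoc)
    also have "\<dots> \<le> image_mset osuc (exps z) + {#} + (\<Sum>i\<in>J. excess z (\<beta> i))"
      unfolding add_0_right
      by (intro add_right_mono less_imp_le osuc_exps_less less J)
    finally show ?thesis by (intro exI[of _ "{#}"]) simp
  next
    case equal
    then show ?thesis
      by (intro exI[of _ "{#}"]) (auto intro!: sum_mono excess_mono le)
  next
    case greater
    then obtain r where r: "zeta \<alpha> = z + r" "excess z (zeta \<alpha>) = exps r"
      by (cases z "zeta \<alpha>" rule: excess_cases) auto
    have rx: "y < x" if "y \<in># exps r" for y
      using excess_less_omega_pow[of "zeta \<alpha>" z x y] that r less zx by simp
    have "exps (zeta \<alpha>) = exps z + exps r"
      unfolding r(1) using rx zx(2) by (intro exps_add_decreasing) (meson less_imp_le less_le_trans)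
    moreover have "excess (zeta \<alpha>) (\<alpha> i) \<le> excess z (\<beta> i)" for i
      using greater by (meson excess_antimono excess_mono le less_imp_le order_trans)
    ultimately show ?thesis
      using rx osuc_less_limit[OF E(3)]
      by (intro exI[of _ "image_mset osuc (exps r)"]) (auto intro!: sum_mono)
  qed
  then obtain X where X: "\<And>y. y \<in># X \<Longrightarrow> y < x"
    "image_mset osuc (exps (zeta \<alpha>)) + (\<Sum>i\<in>J. excess (zeta \<alpha>) (\<alpha> i))
      \<le> image_mset osuc (exps z) + X + (\<Sum>i\<in>J. excess z (\<beta> i))"
    by blast
  have split: "(\<Sum>i\<in>J. excess z (\<beta> i)) = (\<Sum>i\<in>J - E. excess z (\<beta> i)) + (\<Sum>i\<in>E. excess z (\<beta> i))"
    by (rule sum.subset_diff) (use J in \<open>auto simp: J_def\<close>)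
  have small: "y < x" if y: "y \<in># (\<Sum>i\<in>J - E. excess z (\<beta> i))" for y
  proof -
    obtain i where "i \<notin> E" "y \<in># excess z (\<beta> i)" using y J by (auto simp: set_mset_sum)
    then show ?thesis
      using excess_less_omega_pow[of "\<beta> i" z x y] zx by (simp add: E_def not_le)
  qed
  have "exps (S_sum \<alpha>) \<le> image_mset osuc (exps (zeta \<alpha>)) + (\<Sum>i\<in>J. excess (zeta \<alpha>) (\<alpha> i))"
    using exps_S_sum_le_bound[of \<alpha>] bound_exps_superset[OF J, of \<alpha>] by (simp add: J_def)
  also have "\<dots> \<le> image_mset osuc (exps z) + X + (\<Sum>i\<in>J. excess z (\<beta> i))" by (rule X(2))
  also have "\<dots> = (X + (\<Sum>i\<in>J - E. excess z (\<beta> i)))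
      + (image_mset osuc (exps z) + (\<Sum>i\<in>E. excess z (\<beta> i)))"
    by (simp only: split ac_simps)
  also have "\<dots> < {#x#} + (image_mset osuc (exps z) + (\<Sum>i\<in>E. excess z (\<beta> i)))"
    using X(1) small by (intro add_strict_right_mono) auto
  also have "\<dots> = exps (S_sum \<beta>)"
    unfolding exps_S_sum_limit[OF True] z_def x_def E_def by (simp only: ac_simps)
  finally show ?thesis by simp
qed

lemma bound_exps_mono_if_zeta_eq:
  fixes \<alpha> \<beta> :: "nat \<Rightarrow> 'a::infinite ordinal"
  assumes le: "\<And>i. \<alpha> i \<le> \<beta> i" and eq: "zeta \<alpha> = zeta \<beta>"
  shows "bound_exps \<alpha> \<le> bound_exps \<beta>"
    and "zeta \<beta> < \<beta> j \<Longrightarrow> \<alpha> j < \<beta> j \<Longrightarrow> bound_exps \<alpha> < bound_exps \<beta>"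
proof -
  define J where "J = {i. zeta \<beta> < \<beta> i}"
  have "{i. zeta \<alpha> < \<alpha> i} \<subseteq> J" using le eq by (auto simp: J_def intro: less_le_trans)
  then have a: "bound_exps \<alpha> =
      image_mset osuc (exps (zeta \<beta>)) + (\<Sum>i\<in>J. excess (zeta \<beta>) (\<alpha> i))"
    using bound_exps_superset[of J \<alpha>] eq by (simp add: J_def)
  have b: "bound_exps \<beta> =
      image_mset osuc (exps (zeta \<beta>)) + (\<Sum>i\<in>J. excess (zeta \<beta>) (\<beta> i))"
    by (simp add: bound_exps_def J_def)
  show "bound_exps \<alpha> \<le> bound_exps \<beta>"
    unfolding a b by (intro add_left_mono sum_mono excess_mono le)
  assume j: "zeta \<beta> < \<beta> j" "\<alpha> j < \<beta> j"
  show "bound_exps \<alpha> < bound_exps \<beta>"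
    unfolding a b
  proof (intro add_strict_left_mono sum_strict_mono_ex1 ballI excess_mono le)
    show "\<exists>i\<in>J. excess (zeta \<beta>) (\<alpha> i) < excess (zeta \<beta>) (\<beta> i)"
      using j by (auto simp: J_def intro!: bexI[of _ j] excess_strict_mono)
  qed (simp add: J_def)
qed

text \<open>
  The comparison is made over the indices with \<open>zeta \<beta> \<le> \<beta> i\<close>. An index that does not reach
  the threshold in \<open>\<alpha>\<close> contributes nothing to the sum of \<open>\<alpha>\<close>, even though its excess over
  the shortened threshold may be positive; hence the auxiliary summand \<open>f\<close>.
\<close>

lemma S_sum_mono_limit_case:
  fixes \<alpha> \<beta> :: "nat \<Rightarrow> 'a::infinite ordinal"
  assumes le: "\<And>i. \<alpha> i \<le> \<beta> i" and eq: "zeta \<alpha> = zeta \<beta>"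
    and limit: "limit_case \<alpha>" "limit_case \<beta>"
  shows "S_sum \<alpha> \<le> S_sum \<beta>"
    and "zeta \<beta> < \<beta> j \<Longrightarrow> \<alpha> j < \<beta> j \<Longrightarrow> S_sum \<alpha> < S_sum \<beta>"
proof -
  define z where "z = drop_last_summand (zeta \<beta>)"
  define x where "x = last_exponent (zeta \<beta>)"
  define E where "E = {i. zeta \<beta> \<le> \<beta> i}"
  define f where "f i = (if zeta \<beta> \<le> \<alpha> i then excess z (\<alpha> i) else {#})" for i
  have E: "finite E" "zeta \<beta> \<noteq> 0" using limit by (auto simp: limit_case_def E_def)
  have sub: "{i. zeta \<beta> \<le> \<alpha> i} \<subseteq> E" using le by (auto simp: E_def intro: order_trans)
  have "(\<Sum>i\<in>{i. zeta \<beta> \<le> \<alpha> i}. excess z (\<alpha> i)) = sum f E"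
    by (rule sum.mono_neutral_cong_left) (use E sub in \<open>auto simp: f_def\<close>)
  then have a: "exps (S_sum \<alpha>) = image_mset osuc (exps z) + {#x#} + sum f E"
    unfolding exps_S_sum_limit[OF limit(1)] by (simp add: eq z_def x_def)
  have b: "exps (S_sum \<beta>) = image_mset osuc (exps z) + {#x#} + (\<Sum>i\<in>E. excess z (\<beta> i))"
    unfolding exps_S_sum_limit[OF limit(2)] z_def x_def E_def ..
  have f: "f i \<le> excess z (\<beta> i)" for i by (simp add: f_def excess_mono le)
  have "exps (S_sum \<alpha>) \<le> exps (S_sum \<beta>)"
    unfolding a b by (intro add_left_mono sum_mono f)
  then show "S_sum \<alpha> \<le> S_sum \<beta>" by simp
  assume j: "zeta \<beta> < \<beta> j" "\<alpha> j < \<beta> j"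
  have "z < \<beta> j" using drop_last_add[OF E(2)] le_add_ordinal j unfolding z_def
    by (metis le_less_trans)
  then have "f j < excess z (\<beta> j)"
    using j excess_strict_mono[of z "\<beta> j" z] by (auto simp: f_def intro: excess_strict_mono)
  then have "exps (S_sum \<alpha>) < exps (S_sum \<beta>)"
    unfolding a b using j E f
    by (intro add_strict_left_mono sum_strict_mono_ex1 ballI bexI[of _ j]) (auto simp: E_def)
  then show "S_sum \<alpha> < S_sum \<beta>" by simp
qed

text \<open>
  For equal thresholds the limit case passes from \<open>\<beta>\<close> down to \<open>\<alpha>\<close>, since fewer elements of
  \<open>\<alpha>\<close> reach the threshold. So the combination missing from the two preceding lemmas is that
  only \<open>\<alpha>\<close> is in the limit case, and there \<open>bound_exps \<alpha>\<close> is an upper bound.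
\<close>

lemma S_sum_mono_if_zeta_eq:
  fixes \<alpha> \<beta> :: "nat \<Rightarrow> 'a::infinite ordinal"
  assumes le: "\<And>i. \<alpha> i \<le> \<beta> i" and eq: "zeta \<alpha> = zeta \<beta>"
  shows "S_sum \<alpha> \<le> S_sum \<beta>"
    and "zeta \<beta> < \<beta> j \<Longrightarrow> \<alpha> j < \<beta> j \<Longrightarrow> S_sum \<alpha> < S_sum \<beta>"
proof -
  have sub: "{i. zeta \<beta> \<le> \<alpha> i} \<subseteq> {i. zeta \<beta> \<le> \<beta> i}" using le by (auto intro: order_trans)
  have limit_\<alpha>: "limit_case \<alpha>" if "limit_case \<beta>"
    using that finite_subset[OF sub] eq by (auto simp: limit_case_def)
  have b: "exps (S_sum \<beta>) = bound_exps \<beta>" if "\<not> limit_case \<beta>"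
    using exps_S_sum_not_limit[OF that] by (simp add: bound_exps_def)
  note bm = bound_exps_mono_if_zeta_eq[OF le eq]
  note lm = S_sum_mono_limit_case[OF le eq limit_\<alpha>]
  have "exps (S_sum \<alpha>) \<le> exps (S_sum \<beta>)" if "\<not> limit_case \<beta>"
    using b[OF that] bm(1) exps_S_sum_le_bound[of \<alpha>] by (metis order_trans)
  then show "S_sum \<alpha> \<le> S_sum \<beta>" using lm(1) by (cases "limit_case \<beta>") auto
  assume j: "zeta \<beta> < \<beta> j" "\<alpha> j < \<beta> j"
  have "exps (S_sum \<alpha>) < exps (S_sum \<beta>)" if "\<not> limit_case \<beta>"
    using b[OF that] bm(2)[OF j] exps_S_sum_le_bound[of \<alpha>] by (metis le_less_trans)
  then show "S_sum \<alpha> < S_sum \<beta>" using lm(2)[OF _ _ j] by (cases "limit_case \<beta>") auto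
qed

lemma weakly_monotone_S_sum:
  "weakly_monotone (S_sum :: (nat \<Rightarrow> 'a::infinite ordinal) \<Rightarrow> 'a ordinal)"
  unfolding weakly_monotone_def
proof (intro allI impI)
  fix \<alpha> \<beta> :: "nat \<Rightarrow> 'a ordinal" assume "\<forall>i. \<alpha> i \<le> \<beta> i"
  then have le: "\<And>i. \<alpha> i \<le> \<beta> i" by blast
  show "S_sum \<alpha> \<le> S_sum \<beta>"
    using zeta_mono[of \<alpha> \<beta>] S_sum_less_if_zeta_less[of \<alpha> \<beta>]
      S_sum_mono_if_zeta_eq(1)[of \<alpha> \<beta>] le
    by (auto simp: le_less)
qed

lemma strictly_monotone_S_sum:
  "strictly_monotone_on_z_special (S_sum :: (nat \<Rightarrow> 'a::infinite ordinal) \<Rightarrow> 'a ordinal)"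
  unfolding strictly_monotone_on_z_special_def
proof (intro allI impI)
  fix \<alpha> \<beta> :: "nat \<Rightarrow> 'a ordinal"
  assume "(\<forall>i. \<alpha> i \<le> \<beta> i) \<and> (\<exists>i. zeta \<alpha> < \<beta> i \<and> \<alpha> i < \<beta> i)"
  then obtain j where le: "\<And>i. \<alpha> i \<le> \<beta> i" and j: "zeta \<alpha> < \<beta> j" "\<alpha> j < \<beta> j" by blast
  show "S_sum \<alpha> < S_sum \<beta>"
  proof (cases "zeta \<alpha> = zeta \<beta>")
    case True
    then show ?thesis using S_sum_mono_if_zeta_eq(2)[OF le True] j by simp
  next
    case False
    then show ?thesis using zeta_mono[of \<alpha> \<beta>] S_sum_less_if_zeta_less[of \<alpha> \<beta>] le
      by (metis le_neq_trans)
  qed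
qed

section \<open>Approximation from below\<close>

text \<open>
  Infinitely many elements of \<open>\<alpha>\<close> exceed \<open>z\<close> and are cut down to it. They keep the threshold
  at \<open>z\<close>, exclude the limit case, and witness strictness.
\<close>

lemma S_sum_cut:
  fixes \<alpha> :: "nat \<Rightarrow> 'a::infinite ordinal"
  assumes z: "z < zeta \<alpha>" and K: "finite K"
  defines "\<beta> \<equiv> \<lambda>i. if i \<in> K then \<alpha> i else min (\<alpha> i) z"
  shows "zeta \<beta> = z" and "\<exists>i. zeta \<beta> < \<alpha> i \<and> \<beta> i < \<alpha> i"
    and "exps (S_sum \<beta>) = image_mset osuc (exps z) + (\<Sum>i\<in>K. excess z (\<alpha> i))"
proof -
  have inf: "infinite ({i. z < \<alpha> i} - K)" using infinite_above[OF z] K by simp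
  show zeta: "zeta \<beta> = z"
  proof (rule zeta_eqI)
    have "{i. z < \<beta> i} \<subseteq> K" by (auto simp: \<beta>_def)
    then show "finite {i. z < \<beta> i}" using K finite_subset by blast
  next
    fix y assume "y < z"
    then have "{i. z < \<alpha> i} - K \<subseteq> {i. y < \<beta> i}" by (auto simp: \<beta>_def intro: less_trans)
    then show "infinite {i. y < \<beta> i}" using inf finite_subset by blast
  qed
  obtain i where "i \<notin> K" "z < \<alpha> i" using inf infinite_imp_nonempty by blast
  then show "\<exists>i. zeta \<beta> < \<alpha> i \<and> \<beta> i < \<alpha> i" unfolding zeta by (auto simp: \<beta>_def)
  have "{i. z < \<alpha> i} - K \<subseteq> {i. z \<le> \<beta> i}" by (auto simp: \<beta>_def)
  then have "infinite {i. z \<le> \<beta> i}" using inf finite_subset by blast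
  then have "\<not> limit_case \<beta>" by (simp add: limit_case_def zeta)
  then have "exps (S_sum \<beta>) = bound_exps \<beta>"
    using exps_S_sum_not_limit by (simp add: bound_exps_def)
  also have "\<dots> = image_mset osuc (exps z) + (\<Sum>i\<in>K. excess z (\<beta> i))"
    unfolding zeta[symmetric]
    by (rule bound_exps_superset[OF K]) (auto simp: zeta, auto simp: \<beta>_def split: if_splits)
  finally show "exps (S_sum \<beta>) = image_mset osuc (exps z) + (\<Sum>i\<in>K. excess z (\<alpha> i))"
    by (simp add: \<beta>_def)
qed

text \<open>
  For an operation that is strictly monotone on z-special elements and at least \<open>S_sum\<close> at
  \<open>\<beta>\<close>, this property makes the value at \<open>\<alpha>\<close> exceed the ordinal with exponents \<open>G\<close>.
\<close>

definition reached_below :: "(nat \<Rightarrow> 'a::infinite ordinal) \<Rightarrow> 'a ordinal multiset \<Rightarrow> bool" where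
  "reached_below \<alpha> G \<longleftrightarrow>
    (\<exists>\<beta>. (\<forall>i. \<beta> i \<le> \<alpha> i) \<and> (\<exists>i. zeta \<beta> < \<alpha> i \<and> \<beta> i < \<alpha> i) \<and> G \<le> exps (S_sum \<beta>))"

lemma reached_below_cut:
  assumes "z < zeta \<alpha>" "finite K"
    and "G \<le> image_mset osuc (exps z) + (\<Sum>i\<in>K. excess z (\<alpha> i))"
  shows "reached_below \<alpha> G"
  unfolding reached_below_def
  using S_sum_cut[OF assms(1,2)] assms(3)
  by (intro exI[of _ "\<lambda>i. if i \<in> K then \<alpha> i else min (\<alpha> i) z"]) auto

lemma finite_fun_upd_iff:
  fixes \<alpha> :: "nat \<Rightarrow> 'b"
  shows "finite {i. P ((\<alpha>(j := c)) i)} \<longleftrightarrow> finite {i. P (\<alpha> i)}"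
proof -
  have "{i. P ((\<alpha>(j := c)) i)} \<subseteq> insert j {i. P (\<alpha> i)}"
    and "{i. P (\<alpha> i)} \<subseteq> insert j {i. P ((\<alpha>(j := c)) i)}" by auto
  then show ?thesis by (meson finite_insert finite_subset)
qed

lemma zeta_fun_upd [simp]: "zeta (\<alpha>(j := c)) = zeta \<alpha>"
  unfolding zeta_def finite_fun_upd_iff ..

lemma limit_case_fun_upd [simp]: "limit_case (\<alpha>(j := c)) \<longleftrightarrow> limit_case \<alpha>"
  unfolding limit_case_def zeta_fun_upd finite_fun_upd_iff ..

lemma reached_below_fun_upd:
  assumes "zeta \<alpha> < \<alpha> j" "c < \<alpha> j" "G \<le> exps (S_sum (\<alpha>(j := c)))"
  shows "reached_below \<alpha> G"
  unfolding reached_below_def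
  using assms by (intro exI[of _ "\<alpha>(j := c)"]) (auto simp: less_imp_le intro!: exI[of _ j])

lemma sum_fun_upd:
  assumes "finite J" "j \<in> J"
  shows "(\<Sum>i\<in>J. f ((\<alpha>(j := c)) i)) = f c + (\<Sum>i\<in>J - {j}. f (\<alpha> i) :: 'b::comm_monoid_add)"
  using assms by (subst sum.remove[of J j]) (auto intro!: sum.cong)

text \<open>
  To get from the sum down to \<open>G\<close> one decreases either the summand of a single element, which is
  then decreased accordingly, or \<open>\<zeta> \<otimes> \<omega>\<close>. In the latter case write
  \<open>\<zeta> = z + \<omega>\<^sup>x\<close>; the summand \<open>\<omega>\<^bsup>x + 1\<^esup>\<close> is replaced by some
  \<open>\<omega>\<^sup>x \<cdot> n\<close>. If \<open>x = e + 1\<close>, cutting at \<open>z + \<omega>\<^sup>e \<cdot> n\<close> achieves this. Otherwise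
  infinitely many elements reach \<open>\<zeta>\<close>; cutting at \<open>z\<close> and retaining \<open>n\<close> elements
  equal to \<open>\<zeta>\<close> yields \<open>n\<close> summands \<open>\<omega>\<^sup>x\<close>.
\<close>

lemma reached_below_not_limit_case:
  fixes \<alpha> :: "nat \<Rightarrow> 'a::infinite ordinal"
  assumes not_limit: "\<not> limit_case \<alpha>" and G: "G < exps (S_sum \<alpha>)"
  shows "reached_below \<alpha> G"
proof -
  define I where "I = {i. zeta \<alpha> < \<alpha> i}"
  have I: "finite I" by (simp add: I_def)
  have "G < image_mset osuc (exps (zeta \<alpha>)) + (\<Sum>i\<in>I. excess (zeta \<alpha>) (\<alpha> i))"
    using G by (simp add: exps_S_sum_not_limit[OF not_limit] I_def)
  with I show ?thesis
  proof (cases rule: less_plus_sum_cases)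
    case (2 j C')
    define c where "c = zeta \<alpha> + of_exps C'"
    have "c < \<alpha> j"
    proof (cases "zeta \<alpha>" "\<alpha> j" rule: excess_cases)
      case (2 d)
      then have "of_exps C' < d" using \<open>C' < _\<close> exps_less_iff[of "of_exps C'" d] by simp
      then show ?thesis using 2 by (simp add: c_def)
    qed (use 2 in simp)
    moreover have "exps (S_sum (\<alpha>(j := c))) = bound_exps (\<alpha>(j := c))"
      using exps_S_sum_not_limit[of "\<alpha>(j := c)"] not_limit by (simp add: bound_exps_def)
    moreover have "{i. zeta (\<alpha>(j := c)) < (\<alpha>(j := c)) i} \<subseteq> I"
      using 2(1) by (auto simp: I_def split: if_splits)
    then have "bound_exps (\<alpha>(j := c)) = image_mset osuc (exps (zeta \<alpha>))
        + (C' + (\<Sum>i\<in>I - {j}. excess (zeta \<alpha>) (\<alpha> i)))"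
      using bound_exps_superset[of I "\<alpha>(j := c)"] sum_fun_upd[of I j "excess (zeta \<alpha>)" \<alpha> c] 2(1) I
      by (simp add: c_def del: fun_upd_apply)
    ultimately show ?thesis
      using 2 by (intro reached_below_fun_upd[of \<alpha> j c]) (simp_all add: I_def add.assoc)
  next
    case (1 A')
    define z where "z = drop_last_summand (zeta \<alpha>)"
    define x where "x = last_exponent (zeta \<alpha>)"
    have zeta0: "zeta \<alpha> \<noteq> 0" using 1(1) by auto
    have zx: "exps (zeta \<alpha>) = add_mset x (exps z)" "\<And>y. y \<in># exps z \<Longrightarrow> x \<le> y"
      and add: "z + omega_pow x = zeta \<alpha>"
      using exps_drop_last[OF zeta0] last_exponent_le[OF zeta0] drop_last_add[OF zeta0]
      by (simp_all add: z_def x_def)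
    have z_less: "z < zeta \<alpha>" using add omega_pow_pos add_less_cancel_ordinal add_zero_ordinal by metis
    have "A' < add_mset (osuc x) (image_mset osuc (exps z))" using 1(1) zx(1) by simp
    then obtain N where N: "\<And>y. y \<in># N \<Longrightarrow> y < osuc x" "A' \<le> image_mset osuc (exps z) + N"
      by (rule less_add_min_cases) (use zx(2) in auto)
    define n where "n = size N"
    have "N \<le> replicate_mset n x" unfolding n_def using N(1) by (intro le_replicate_mset) simp
    then have G': "G \<le> image_mset osuc (exps z) + replicate_mset n x
        + (\<Sum>i\<in>I. excess (zeta \<alpha>) (\<alpha> i))"
      using 1(2) N(2) by (meson add_left_mono add_right_mono order_trans)
    show ?thesis
    proof (cases "is_succ x")
      case True
      then obtain e where e: "x = osuc e" by (auto simp: is_succ_def)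
      define w where "w = of_exps (exps z + replicate_mset n e)"
      have "exps z + replicate_mset n e < exps (zeta \<alpha>)"
      proof -
        have "exps z + replicate_mset n e < exps z + {#x#}"
          by (intro add_strict_left_mono) (auto simp: e less_osuc)
        then show ?thesis by (simp add: zx(1))
      qed
      then have "w < zeta \<alpha>" using exps_less_iff[of w "zeta \<alpha>"] by (simp add: w_def)
      moreover have "G \<le> image_mset osuc (exps w) + (\<Sum>i\<in>I. excess w (\<alpha> i))"
        using calculation
        by (intro order_trans[OF G'] add_mono sum_mono excess_antimono) (simp_all add: w_def e less_imp_le)
      ultimately show ?thesis using I by (intro reached_below_cut)
    next
      case False
      \<comment> \<open>For \<open>x = 0\<close> the threshold is the successor of \<open>z\<close>, and infinitely many elements exceed \<open>z\<close>;
      for a limit \<open>x\<close> the claim holds since \<open>\<alpha>\<close> is not in the limit case.\<close>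
      have "infinite {i. zeta \<alpha> \<le> \<alpha> i}"
      proof (cases "x = 0")
        case True
        then have "zeta \<alpha> = osuc z" using add by simp
        then show ?thesis using infinite_above[OF z_less] by simp
      next
        case False
        then show ?thesis
          using not_limit \<open>\<not> is_succ x\<close> zeta0 by (auto simp: limit_case_def is_limit_def x_def)
      qed
      then have "infinite ({i. zeta \<alpha> \<le> \<alpha> i} - I)" using I by simp
      then obtain K where K: "K \<subseteq> {i. zeta \<alpha> \<le> \<alpha> i} - I" "finite K" "card K = n"
        by (meson infinite_arbitrarily_large)
      have "replicate_mset n x = (\<Sum>i\<in>K. excess z (\<alpha> i))"
      proof -
        have "(\<Sum>i\<in>K. excess z (\<alpha> i)) = (\<Sum>i\<in>K. {#x#})"
        proof (rule sum.cong)
          fix i assume "i \<in> K"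
          then have "\<alpha> i = zeta \<alpha>" using K(1) by (auto simp: I_def not_less intro: order_antisym)
          then show "excess z (\<alpha> i) = {#x#}"
            using excess_drop_last[OF zeta0] by (simp add: z_def x_def)
        qed simp
        also have "\<dots> = replicate_mset n x"
          using K(2) unfolding K(3)[symmetric] by (induction K rule: finite_induct) auto
        finally show ?thesis ..
      qed
      moreover have "(\<Sum>i\<in>I. excess (zeta \<alpha>) (\<alpha> i)) \<le> (\<Sum>i\<in>I. excess z (\<alpha> i))"
        using z_less by (intro sum_mono excess_antimono) simp
      ultimately have "G \<le> image_mset osuc (exps z)
          + ((\<Sum>i\<in>K. excess z (\<alpha> i)) + (\<Sum>i\<in>I. excess z (\<alpha> i)))"
        using G' by (simp only: add.assoc) (meson add_left_mono order_trans)
      also have "(\<Sum>i\<in>K. excess z (\<alpha> i)) + (\<Sum>i\<in>I. excess z (\<alpha> i)) = (\<Sum>i\<in>K \<union> I. excess z (\<alpha> i))"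
        by (rule sum.union_disjoint[symmetric]) (use K I in auto)
      finally show ?thesis using K I z_less by (intro reached_below_cut[of z _ "K \<union> I"]) auto
    qed
  qed
qed

text \<open>
  Write \<open>\<zeta> = z + \<omega>\<^sup>x\<close>. If \<open>\<omega>\<^sup>x\<close> is decreased to an ordinal with exponents at most
  \<open>e < x\<close>, cut at \<open>z + \<omega>\<^sup>e\<close> and retain the elements that reach \<open>\<zeta>\<close>: the cut has
  \<open>\<omega>\<^bsup>e + 1\<^esup>\<close> in place of \<open>\<omega>\<^sup>x\<close>, while the excesses of the retained elements are
  unchanged because \<open>\<omega>\<^sup>e + \<omega>\<^sup>x = \<omega>\<^sup>x\<close>. If the summand of a single element is decreased, that
  element can be decreased but has to stay at least \<open>\<zeta>\<close>. This is impossible if it equals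
  \<open>\<zeta>\<close>; but then its summand is itself \<open>\<omega>\<^sup>x\<close> and may change roles with the separate
  \<open>\<omega>\<^sup>x\<close>.
\<close>

lemma reached_below_limit_case:
  fixes \<alpha> :: "nat \<Rightarrow> 'a::infinite ordinal"
  assumes limit: "limit_case \<alpha>" and G: "G < exps (S_sum \<alpha>)"
  shows "reached_below \<alpha> G"
proof -
  define z where "z = drop_last_summand (zeta \<alpha>)"
  define x where "x = last_exponent (zeta \<alpha>)"
  define E where "E = {i. zeta \<alpha> \<le> \<alpha> i}"
  have E: "finite E" "zeta \<alpha> \<noteq> 0" "is_limit x"
    using limit by (auto simp: limit_case_def E_def x_def)
  have zx: "\<And>y. y \<in># exps z \<Longrightarrow> x \<le> y" "z + omega_pow x = zeta \<alpha>"
    using last_exponent_le[OF E(2)] drop_last_add[OF E(2)] by (simp_all add: z_def x_def)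
  have zeta: "exps (S_sum \<beta>) =
      image_mset osuc (exps z) + {#x#} + (\<Sum>i\<in>{i. zeta \<alpha> \<le> \<beta> i}. excess z (\<beta> i))"
    if "limit_case \<beta>" "zeta \<beta> = zeta \<alpha>" for \<beta>
    using exps_S_sum_limit[OF that(1)] that(2) by (simp add: z_def x_def)
  \<comment> \<open>The separate summand \<open>\<omega>\<^sup>x\<close> is decreased to exponents \<open>N\<close>.\<close>
  have lower: ?thesis
    if N: "\<And>y. y \<in># N \<Longrightarrow> y < x"
      and le: "G \<le> image_mset osuc (exps z) + N + (\<Sum>i\<in>E. excess z (\<alpha> i))" for N
  proof -
    obtain e where e: "e < x" "\<And>y. y \<in># N \<Longrightarrow> y \<le> e"
    proof (cases "N = {#}")
      case True
      then show thesis using that[of 0] zero_less_limit[OF E(3)] by simp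
    next
      case False
      then show thesis using that[of "Max (set_mset N)"] N by simp
    qed
    define w where "w = z + omega_pow e"
    have expsw: "exps w = add_mset e (exps z)"
      unfolding w_def using zx(1) e(1)
      by (subst exps_add_decreasing) (auto, meson less_imp_le less_le_trans)
    have "w < zeta \<alpha>" unfolding w_def zx(2)[symmetric] using e by simp
    moreover have same: "excess w (\<alpha> i) = excess z (\<alpha> i)" if i: "i \<in> E" for i
    proof -
      obtain c where "\<alpha> i = zeta \<alpha> + c" using i ex_add_eq unfolding E_def by (metis mem_Collect_eq)
      then have c: "\<alpha> i = z + (omega_pow x + c)" by (simp add: zx(2)[symmetric] add_assoc_ordinal)
      also have "\<dots> = z + (omega_pow e + omega_pow x + c)"
        using e(1) by (subst add_omega_pow_absorb) simp_all
      also have "\<dots> = w + (omega_pow x + c)" by (simp add: w_def add_assoc_ordinal)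
      finally show ?thesis using c by (metis excess_add)
    qed
    moreover have "G \<le> image_mset osuc (exps w) + (\<Sum>i\<in>E. excess w (\<alpha> i))"
    proof -
      have "N < {#osuc e#}" using e(2) by simp
      then have "image_mset osuc (exps z) + N \<le> image_mset osuc (exps w)"
        unfolding expsw by (simp add: less_imp_le)
      moreover have "(\<Sum>i\<in>E. excess w (\<alpha> i)) = (\<Sum>i\<in>E. excess z (\<alpha> i))"
        using same by (rule sum.cong[OF refl])
      ultimately show ?thesis using le by (metis add_right_mono order_trans)
    qed
    ultimately show ?thesis using E by (intro reached_below_cut)
  qed
  have "G < image_mset osuc (exps z) + {#x#} + (\<Sum>i\<in>E. excess z (\<alpha> i))"
    using G by (simp add: zeta limit E_def)
  with E(1) show ?thesis
  proof (cases rule: less_plus_sum_cases)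
    case (1 A')
    have "A' < add_mset x (image_mset osuc (exps z))" using 1(1) by simp
    then obtain N where "\<And>y. y \<in># N \<Longrightarrow> y < x" "A' \<le> image_mset osuc (exps z) + N"
      by (rule less_add_min_cases) (use zx(1) in \<open>auto simp: less_imp_le intro: le_less_trans[OF _ less_osuc]\<close>)
    then show ?thesis using 1(2) lower[of N] by (meson add_right_mono order_trans)
  next
    case (2 j C')
    obtain c where "\<alpha> j = zeta \<alpha> + c" using 2(1) ex_add_eq unfolding E_def by (metis mem_Collect_eq)
    then have c: "\<alpha> j = z + (omega_pow x + c)" by (simp add: zx(2)[symmetric] add_assoc_ordinal)
    have C': "of_exps C' < omega_pow x + c"
      using 2(2) exps_less_iff[of "of_exps C'" "omega_pow x + c"] by (simp add: c)
    show ?thesis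
    proof (cases "c = 0 \<and> of_exps C' < omega_pow x")
      case True
      have "(\<Sum>i\<in>E. excess z (\<alpha> i)) = {#x#} + (\<Sum>i\<in>E - {j}. excess z (\<alpha> i))"
        using E(1) 2(1) True c by (subst sum.remove) auto
      then have "G \<le> image_mset osuc (exps z) + C' + (\<Sum>i\<in>E. excess z (\<alpha> i))"
        using 2(3) by (simp add: ac_simps)
      moreover have "y < x" if "y \<in># C'" for y
        using True that by (simp add: less_omega_pow_iff)
      ultimately show ?thesis using lower by blast
    next
      case False
      \<comment> \<open>The maximum keeps the changed element at or above the threshold.\<close>
      define b where "b = max (omega_pow x) (of_exps C')"
      have b: "omega_pow x \<le> b" "C' \<le> exps b"
        using exps_le_iff[of "of_exps C'" b] by (simp_all add: b_def)
      have "b < omega_pow x + c"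
        using False C' add_less_cancel_ordinal[of "omega_pow x" 0 c]
        by (auto simp: b_def max_def zero_less_ordinal_iff not_less)
      then have less: "z + b < \<alpha> j" by (simp add: c)
      have ge: "zeta \<alpha> \<le> z + b" using b(1) by (simp add: zx(2)[symmetric])
      have set: "{i. zeta \<alpha> \<le> (\<alpha>(j := z + b)) i} = E"
        using 2(1) ge by (auto simp: E_def)
      have "exps (S_sum (\<alpha>(j := z + b))) =
          image_mset osuc (exps z) + {#x#} + (exps b + (\<Sum>i\<in>E - {j}. excess z (\<alpha> i)))"
        using zeta[of "\<alpha>(j := z + b)"] limit E(1) 2(1)
          sum_fun_upd[of E j "excess z" \<alpha> "z + b"]
        unfolding set by auto
      moreover have "G \<le> image_mset osuc (exps z) + {#x#}
          + (exps b + (\<Sum>i\<in>E - {j}. excess z (\<alpha> i)))"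
        using 2(3) b(2) by (simp only: add.assoc) (meson add_left_mono add_right_mono order_trans)
      ultimately show ?thesis
        using less ge by (intro reached_below_fun_upd[of \<alpha> j "z + b"]) auto
    qed
  qed
qed

lemma S_sum_reached_below:
  fixes \<alpha> :: "nat \<Rightarrow> 'a::infinite ordinal"
  assumes "c < S_sum \<alpha>"
  obtains \<beta> where "\<And>i. \<beta> i \<le> \<alpha> i" "\<exists>i. zeta \<beta> < \<alpha> i \<and> \<beta> i < \<alpha> i" "c \<le> S_sum \<beta>"
proof -
  have "exps c < exps (S_sum \<alpha>)" using assms by simp
  then have "reached_below \<alpha> (exps c)"
    using reached_below_limit_case reached_below_not_limit_case by blast
  then show thesis using that by (auto simp: reached_below_def)
qed

section \<open>Minimality\<close>

text \<open>
  If \<open>b\<close> were smaller than \<open>a\<close>, it would be isomorphic to some \<open>c < a\<close>, and then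
  \<open>c \<preceq> d < b\<close> is a contradiction.
\<close>

lemma ordinal_le_if_all_less:
  fixes a :: "'a ordinal" and b :: "'b ordinal"
  assumes "\<And>c. c < a \<Longrightarrow> \<exists>d<b. c \<preceq> d"
  shows "a \<preceq> b"
proof (rule ccontr)
  have wo: "Well_order (rep_ordinal x)" for x :: "'c ordinal"
    using Quotient_rep_reflp[OF Quotient_ordinal, of x] ordIso_imp_Well_order by blast
  assume "\<not> a \<preceq> b"
  then have "(rep_ordinal b, rep_ordinal a) \<in> ordLess"
    using wo[of a] wo[of b] not_ordLeq_iff_ordLess unfolding ordinal_le_def by blast
  then obtain x where x: "x \<in> Field (rep_ordinal a)"
    and iso: "(rep_ordinal b, Restr (rep_ordinal a) (underS (rep_ordinal a) x)) \<in> ordIso"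
    using wo[of a] wo[of b] ordLess_iff_ordIso_Restr by blast
  define r where "r = Restr (rep_ordinal a) (underS (rep_ordinal a) x)"
  have r: "Well_order r" unfolding r_def using wo by (rule Well_order_Restr)
  have rep: "(rep_ordinal (abs_ordinal r), r) \<in> ordIso"
    using r Quotient_rep_abs[OF Quotient_ordinal] ordIso_reflexive by blast
  have "(r, rep_ordinal a) \<in> ordLess"
    unfolding r_def by (rule underS_Restr_ordLess[OF wo]) (use x in auto)
  then have "abs_ordinal r < a"
    using ordIso_ordLess_trans[OF rep] by (simp add: less_ordinal.rep_eq)
  then obtain d where d: "d < b" "abs_ordinal r \<preceq> d" using assms by blast
  have "(rep_ordinal b, rep_ordinal (abs_ordinal r)) \<in> ordIso"
    by (rule ordIso_transitive[OF iso[folded r_def] ordIso_symmetric[OF rep]])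
  then have "(rep_ordinal b, rep_ordinal d) \<in> ordLeq"
    using d(2) unfolding ordinal_le_def by (rule ordIso_ordLeq_trans)
  then have "b \<le> d" by (simp add: less_eq_ordinal.rep_eq)
  then show False using d(1) by simp
qed

lemma ordinal_le_trans: "a \<le> b \<Longrightarrow> b \<preceq> c \<Longrightarrow> a \<preceq> c"
  unfolding ordinal_le_def less_eq_ordinal.rep_eq by (rule ordLeq_transitive)

lemma S_sum_least:
  fixes F :: "(nat \<Rightarrow> 'a::infinite ordinal) \<Rightarrow> 'b ordinal"
  assumes F: "strictly_monotone_on_z_special F"
  shows "S_sum \<alpha> \<preceq> F \<alpha>"
proof (induction "S_sum \<alpha>" arbitrary: \<alpha> rule: less_induct)
  case less
  show ?case
  proof (rule ordinal_le_if_all_less)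
    fix c assume "c < S_sum \<alpha>"
    then obtain \<beta> where \<beta>: "\<And>i. \<beta> i \<le> \<alpha> i" "\<exists>i. zeta \<beta> < \<alpha> i \<and> \<beta> i < \<alpha> i" "c \<le> S_sum \<beta>"
      using S_sum_reached_below by blast
    have "S_sum \<beta> < S_sum \<alpha>"
      using strictly_monotone_S_sum \<beta>(1,2) unfolding strictly_monotone_on_z_special_def by blast
    then have "c \<preceq> F \<beta>" using less \<beta>(3) ordinal_le_trans by blast
    moreover have "F \<beta> < F \<alpha>"
      using F \<beta>(1,2) unfolding strictly_monotone_on_z_special_def by blast
    ultimately show "\<exists>d<F \<alpha>. c \<preceq> d" by blast
  qed
qed

section \<open>Inserted zeros and constant sequences\<close>

text \<open>
  The inserted indices never satisfy \<open>z < \<beta> j\<close>, nor \<open>z \<le> \<beta> j\<close> if \<open>z \<noteq> 0\<close>, and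
  the definition of the sum only uses such conditions.
\<close>

lemma S_sum_insert_zeros:
  fixes \<alpha> \<beta> :: "nat \<Rightarrow> 'a::infinite ordinal"
  assumes f: "inj f" and range: "\<And>i. \<beta> (f i) = \<alpha> i" and zero: "\<And>j. j \<notin> range f \<Longrightarrow> \<beta> j = 0"
  shows "S_sum \<beta> = S_sum \<alpha>"
proof -
  have image: "{j. P (\<beta> j)} = f ` {i. P (\<alpha> i)}" if "\<not> P 0" for P
    using range zero that by (auto simp: image_iff) (metis rangeE)
  have fin: "finite {j. P (\<beta> j)} \<longleftrightarrow> finite {i. P (\<alpha> i)}" if "\<not> P 0" for P
    using image[of P] that f by (simp add: finite_image_iff inj_on_subset)
  have sum: "(\<Sum>j\<in>{j. P (\<beta> j)}. g (\<beta> j)) = (\<Sum>i\<in>{i. P (\<alpha> i)}. g (\<alpha> i))" if "\<not> P 0"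
    for P and g :: "'a ordinal \<Rightarrow> 'a ordinal multiset"
    unfolding image[of P, OF that] using f range
    by (subst sum.reindex) (auto intro: inj_on_subset)
  have zeta: "zeta \<beta> = zeta \<alpha>"
    unfolding zeta_def by (subst fin) simp_all
  have limit: "limit_case \<beta> \<longleftrightarrow> limit_case \<alpha>"
    using fin[of "\<lambda>a. zeta \<alpha> \<le> a"] by (auto simp: limit_case_def zeta)
  have "exps (S_sum \<beta>) = exps (S_sum \<alpha>)"
  proof (cases "limit_case \<alpha>")
    case True
    then have "zeta \<alpha> \<noteq> 0" by (simp add: limit_case_def)
    then show ?thesis
      using exps_S_sum_limit[of \<alpha>] exps_S_sum_limit[of \<beta>] True limit
        sum[of "\<lambda>a. zeta \<alpha> \<le> a" "excess (drop_last_summand (zeta \<alpha>))"] by (simp add: zeta)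
  next
    case False
    then show ?thesis
      using exps_S_sum_not_limit[of \<alpha>] exps_S_sum_not_limit[of \<beta>] limit
        sum[of "\<lambda>a. zeta \<alpha> < a" "excess (zeta \<alpha>)"] by (simp add: zeta)
  qed
  then show ?thesis by simp
qed

lemma S_sum_const: "S_sum (\<lambda>i. a) = a \<otimes> omega"
proof -
  have zeta: "zeta (\<lambda>i :: nat. a) = a" by (rule zeta_eqI) auto
  then have "\<not> limit_case (\<lambda>i. a)" by (simp add: limit_case_def)
  then have "exps (S_sum (\<lambda>i. a)) = exps (a \<otimes> omega)"
    by (simp add: exps_S_sum_not_limit zeta)
  then show ?thesis by (simp only: exps_eq_iff)
qed

theorem theorem3p4:
  shows "(weakly_monotone (S_sum :: (nat \<Rightarrow> 'a::infinite ordinal) \<Rightarrow> 'a ordinal)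
      \<and> strictly_monotone_on_z_special (S_sum :: (nat \<Rightarrow> 'a ordinal) \<Rightarrow> 'a ordinal))
    \<and> (\<forall>(F :: (nat \<Rightarrow> 'a ordinal) \<Rightarrow> 'b ordinal) \<alpha>.
          strictly_monotone_on_z_special F \<longrightarrow> S_sum \<alpha> \<preceq> F \<alpha>)
    \<and> (\<forall>(\<alpha> :: nat \<Rightarrow> 'a ordinal) \<beta> f :: nat \<Rightarrow> nat.
          strict_mono f \<and> (\<forall>i. \<beta> (f i) = \<alpha> i) \<and> (\<forall>j. j \<notin> range f \<longrightarrow> \<beta> j = 0)
          \<longrightarrow> S_sum \<beta> = S_sum \<alpha>)
    \<and> (\<forall>\<alpha> :: 'a ordinal. S_sum (\<lambda>i. \<alpha>) = \<alpha> \<otimes> omega)"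
  using weakly_monotone_S_sum strictly_monotone_S_sum S_sum_least S_sum_const
  by (auto intro!: S_sum_insert_zeros strict_mono_imp_inj_on)

end
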